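(* Let $k>1$ be an odd integer. Then for all integers $n\ge 0$: \begin{align*} p_{[1,2;-(3^{k}-5b)/b]}\left(3^{k} n+\frac{7\cdot 3^{k}-5}{8}\right)&\equiv 0 \pmod{3^{k}},\\ p_{[1,2;-(5^{k}-3b)/b]}\left(5^{k} n+\frac{7\cdot 5^{k}-3}{8}\right)&\equiv 0 \pmod{5^{k}},\\ p_{[1,3;-(5^{k}-3b)/b]}\left(5^{k} n+\frac{5^{k}-1}{2}\right)&\equiv 0 \pmod{5^{k}}, \end{align*} where in each congruence $b$ is any positive integer coprime to the modulus (i.e. to $3$, $5$, $5$ respectively).
   Context: For a rational number $t$ and an integer $m>1$, the rational numbers $p_{[1,m;t]}(n)$, $n\ge 0$, are defined by the formal power series identity $\sum_{n\ge 0}p_{[1,m;t]}(n)q^n=\prod_{j\ge 1}\big((1-q^j)(1-q^{mj})\big)^t$, where each power is the binomial series with constant term $1$. For a prime $\ell$ not dividing the denominator of $t$, a congruence $p_{[1,m;t]}(N)\equiv 0\pmod{\ell^k}$ means that the numerator of $p_{[1,m;t]}(N)$, written as a reduced fraction, is divisible by $\ell^k$ (the denominator is then coprime to $\ell$). *)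

theory Defs
  imports "HOL-Analysis.Infinite_Products" "HOL-Computational_Algebra.Formal_Power_Series"
begin

text \<open>
  The binomial series of \<open>F\<close> to the rational exponent \<open>t\<close>, i.e. the sum over \<open>k\<close> of
  \<open>(t gchoose k) * (F - 1) ^ k\<close>. It is meaningful only if \<open>F\<close> has constant term 1, since
  composition of formal power series requires a vanishing constant term of the inner series.
\<close>
definition fps_rat_power :: "rat fps \<Rightarrow> rat \<Rightarrow> rat fps" where
  "fps_rat_power F t = fps_binomial t oo (F - 1)"

text \<open>
  The infinite product is taken in the usual (coefficientwise) topology on formal power series;
  the factor with index \<open>j = 1, 2, \<dots>\<close> appears at position \<open>j - 1\<close>.
\<close>
definition p1_factor :: "nat \<Rightarrow> rat \<Rightarrow> nat \<Rightarrow> rat fps" where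
  "p1_factor m t j = fps_rat_power ((1 - fps_X ^ j) * (1 - fps_X ^ (m * j))) t"

definition p1_gf :: "nat \<Rightarrow> rat \<Rightarrow> rat fps" where
  "p1_gf m t = (\<Prod>j. p1_factor m t (Suc j))"

definition p1 :: "nat \<Rightarrow> rat \<Rightarrow> nat \<Rightarrow> rat" where
  "p1 m t n = fps_nth (p1_gf m t) n"

text \<open>
  The function \<open>quotient_of\<close> returns the reduced fraction with positive denominator. If \<open>M > 1\<close>
  divides the numerator, the denominator is automatically coprime to \<open>M\<close>.
\<close>
definition rat_cong_0 :: "rat \<Rightarrow> int \<Rightarrow> bool" where
  "rat_cong_0 x M \<longleftrightarrow> M dvd fst (quotient_of x)"

text \<open>The product converges, so \<open>p1_gf\<close> is not a junk value of \<open>prodinf\<close>.\<close>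

lemma p1_factor_nth_0 [simp]: "fps_nth (p1_factor m t j) 0 = 1"
  by (simp add: p1_factor_def fps_rat_power_def)

lemma p1_factor_nth_eq_0:
  assumes "m > 0" "0 < i" "i < j"
  shows   "fps_nth (p1_factor m t j) i = 0"
proof -
  define G :: "rat fps" where "G = (1 - fps_X ^ j) * (1 - fps_X ^ (m * j)) - 1"
  have G: "G = fps_X ^ j * (fps_X ^ (m * j) - 1 - fps_X ^ ((m - 1) * j))"
    using assms(1) by (cases m) (simp_all add: G_def algebra_simps power_add)
  have "fps_nth (G ^ k) i = 0" if "k > 0" for k
  proof -
    have "fps_X ^ j dvd G ^ k"
      using that by (intro dvd_trans[OF _ dvd_power]) (auto simp: G)
    then obtain H where "G ^ k = fps_X ^ j * H" ..
    thus ?thesis using assms by (simp add: fps_X_power_mult_nth)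
  qed
  hence *: "fps_nth (G ^ k) i = 0" for k
    using assms by (cases "k = 0") auto
  show ?thesis
    unfolding p1_factor_def fps_rat_power_def G_def [symmetric] by (simp add: fps_compose_nth *)
qed

lemma p1_gf_has_prod:
  assumes "m > 0"
  shows   "(\<lambda>j. p1_factor m t (Suc j)) has_prod p1_gf m t"
proof -
  define Q where "Q = (\<lambda>N. \<Prod>j\<le>N. p1_factor m t (Suc j))"
  define P where "P = Abs_fps (\<lambda>n. fps_nth (Q n) n)"
  have step: "fps_nth (Q (Suc N)) n = fps_nth (Q N) n" if "n \<le> N" for n N
  proof -
    have "fps_nth (Q (Suc N)) n =
            (\<Sum>i=0..n. fps_nth (p1_factor m t (Suc (Suc N))) i * fps_nth (Q N) (n - i))"
      by (simp add: Q_def fps_mult_nth mult.commute[of "prod _ _"])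
    also have "\<dots> = (\<Sum>i\<in>{0}. fps_nth (p1_factor m t (Suc (Suc N))) i * fps_nth (Q N) (n - i))"
      using that assms by (intro sum.mono_neutral_right) (auto intro!: p1_factor_nth_eq_0)
    finally show ?thesis by simp
  qed
  have stable: "fps_nth (Q N) n = fps_nth P n" if "n \<le> N" for n N
    using that by (induction rule: dec_induct) (simp_all add: step P_def)
  have "Q \<longlonglongrightarrow> P"
    by (rule tendsto_fpsI, rule eventually_mono[OF eventually_ge_at_top]) (rule stable)
  moreover have "fps_nth P 0 = 1"
    by (simp add: P_def Q_def)
  hence "P \<noteq> 0" by auto
  ultimately have "(\<lambda>j. p1_factor m t (Suc j)) has_prod P"
    by (simp add: has_prod_def raw_has_prod_def Q_def)
  thus ?thesis
    unfolding p1_gf_def using has_prod_unique by metis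
qed

text \<open>For odd \<open>k\<close>, the divisions below are exact.\<close>

lemma eight_dvd_offset_3: "odd k \<Longrightarrow> (8::nat) dvd 7 * 3 ^ k - 5"
proof (elim oddE)
  fix j assume k: "k = 2 * j + 1"
  have "(9::nat) ^ j mod 8 = 1"
    by (induction j) (simp_all, presburger)
  moreover have "(3::nat) ^ k = 3 * 9 ^ j" by (simp add: k power_mult)
  ultimately show ?thesis by presburger
qed

lemma eight_dvd_offset_5: "odd k \<Longrightarrow> (8::nat) dvd 7 * 5 ^ k - 3"
proof (elim oddE)
  fix j assume k: "k = 2 * j + 1"
  have "(25::nat) ^ j mod 8 = 1"
    by (induction j) (simp_all, presburger)
  moreover have "(5::nat) ^ k = 5 * 25 ^ j" by (simp add: k power_mult)
  ultimately show ?thesis by presburger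
qed

lemma two_dvd_offset_5: "(2::nat) dvd 5 ^ k - 1"
  by simp

end

theory Submission
  imports Defs "HOL-Computational_Algebra.Formal_Laurent_Series" "HOL-Number_Theory.Residues"
begin

text \<open>
  Write \<open>f\<^sub>d\<close> for the product of all \<open>1 - q\<^bsup>dj\<^esup>\<close>. With \<open>E = f\<^sub>1 f\<^sub>m\<close> and \<open>G = E\<^bsup>-1/b\<^esup>\<close>, which is integral
  at \<open>l\<close>, the generating function is \<open>E\<^sup>a G\<^bsup>l^k\<^esup>\<close> with \<open>a = 5\<close> for \<open>l = 3\<close> and \<open>a = 3\<close> for \<open>l = 5\<close>.
  The power \<open>E\<^sup>a\<close> is a theta series of a binary form that is anisotropic modulo \<open>l\<close>, weighted by a
  homogeneous polynomial of even degree \<open>a - 1\<close>. If the form represents a multiple of \<open>l\<close>, both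
  variables are therefore divisible by \<open>l\<close>, and \<open>E\<^sup>a\<close> reproduces itself on the corresponding
  progression up to a factor \<open>\<plusminus>l\<^bsup>a-1\<^esup>\<close>, a multiple of \<open>l\<^sup>2\<close>. Since
  \<open>G(q)\<^bsup>l^k\<^esup>\<close> is congruent to \<open>G(q\<^sup>l)\<^bsup>l^(k-1)\<^esup>\<close> modulo \<open>l\<^sup>k\<close>, this lowers \<open>k\<close> by 2 and gains \<open>l\<^sup>2\<close>.

  For \<open>a = 3\<close> the theta series come from Jacobi's formula for \<open>f\<^sub>1\<^sup>3\<close>. For \<open>a = 5\<close>, with \<open>q\<close> replaced
  by \<open>-q\<close>, the theta series is the Wronskian of \<open>f\<^sub>1\<^sup>3\<close> and \<open>f\<^sub>4\<^sup>3\<close>. As \<open>f\<^sub>1 / f\<^sub>4\<close> is up to a power the quotient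
  of Gauss's products \<open>f\<^sub>1\<^sup>2 / f\<^sub>2\<close> and \<open>f\<^sub>4\<^sup>2 / f\<^sub>2\<close>, this reduces to the Wronskian of these, which is
  found by squaring Jacobi's series and rotating the lattice of summation, as in Hirschhorn's proof of
  Jacobi's four-square theorem.
\<close>

text \<open>This simproc would turn equations between power series into equations between polynomials.\<close>

declare [[simproc del: poly_fps_eq]]

subsection \<open>Limits of formal power series\<close>

lemma tendsto_fps_mult:
  fixes f g :: "'a \<Rightarrow> 'b::comm_ring_1 fps"
  assumes "(f \<longlongrightarrow> a) F" "(g \<longlongrightarrow> b) F"
  shows   "((\<lambda>x. f x * g x) \<longlongrightarrow> a * b) F"
proof (rule tendsto_fpsI)
  fix n
  have "eventually (\<lambda>x. \<forall>i\<in>{..n}. fps_nth (f x) i = fps_nth a i) F"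
       "eventually (\<lambda>x. \<forall>i\<in>{..n}. fps_nth (g x) i = fps_nth b i) F"
    using assms by (auto simp: tendsto_fps_iff intro!: eventually_ball_finite)
  thus "eventually (\<lambda>x. fps_nth (f x * g x) n = fps_nth (a * b) n) F"
    by eventually_elim (simp add: fps_mult_nth)
qed

lemma tendsto_fps_power:
  fixes f :: "'a \<Rightarrow> 'b::comm_ring_1 fps"
  assumes "(f \<longlongrightarrow> a) F"
  shows   "((\<lambda>x. f x ^ n) \<longlongrightarrow> a ^ n) F"
  using assms by (induction n) (auto intro!: tendsto_fps_mult)

lemma tendsto_fps_compose:
  fixes f :: "'a \<Rightarrow> 'b::comm_ring_1 fps"
  assumes "(f \<longlongrightarrow> a) F"
  shows   "((\<lambda>x. f x oo h) \<longlongrightarrow> a oo h) F"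
proof (rule tendsto_fpsI)
  fix n
  have "eventually (\<lambda>x. \<forall>i\<in>{..n}. fps_nth (f x) i = fps_nth a i) F"
    using assms by (auto simp: tendsto_fps_iff intro!: eventually_ball_finite)
  thus "eventually (\<lambda>x. fps_nth (f x oo h) n = fps_nth (a oo h) n) F"
    by eventually_elim (simp add: fps_compose_nth)
qed

subsection \<open>Theta series\<close>

text \<open>The formal sum of \<open>w i\<close> times q to the power \<open>e i\<close> over an
  arbitrary index type. As a sum over an infinite set is 0 by convention, this is the intended
  series only when every fibre of \<open>e\<close> is finite.\<close>

definition theta_fps :: "('i \<Rightarrow> 'a::comm_ring_1) \<Rightarrow> ('i \<Rightarrow> nat) \<Rightarrow> 'a fps" where
  "theta_fps w e = Abs_fps (\<lambda>n. \<Sum>i | e i = n. w i)"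

lemma theta_fps_nth: "fps_nth (theta_fps w e) n = (\<Sum>i | e i = n. w i)"
  by (simp add: theta_fps_def)

lemma finite_fibres_atMost:
  fixes e :: "'i \<Rightarrow> nat"
  assumes "\<And>n. finite {i. e i = n}"
  shows   "finite {i. e i \<le> n}"
proof -
  have "{i. e i \<le> n} = (\<Union>k\<le>n. {i. e i = k})" by auto
  thus ?thesis using assms by simp
qed

lemma theta_fps_mult_nth:
  assumes "\<And>n. finite {i. e i = n}"
  shows   "fps_nth (theta_fps w e * g) n = (\<Sum>i | e i \<le> n. w i * fps_nth g (n - e i))"
proof -
  have "fps_nth (theta_fps w e * g) n = (\<Sum>k\<le>n. \<Sum>i | e i = k. w i * fps_nth g (n - k))"
    by (simp add: fps_mult_nth theta_fps_nth sum_distrib_right atLeast0AtMost)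
  also have "\<dots> = (\<Sum>k\<le>n. \<Sum>i | i \<in> {i. e i \<le> n} \<and> e i = k. w i * fps_nth g (n - e i))"
    by (intro sum.cong) auto
  also have "\<dots> = (\<Sum>i | e i \<le> n. w i * fps_nth g (n - e i))"
    by (rule sum.group) (auto intro: finite_fibres_atMost assms)
  finally show ?thesis .
qed

lemma theta_fps_mult:
  assumes "\<And>n. finite {i. e i = n}" "\<And>n. finite {i. e' i = n}"
  shows   "theta_fps w e * theta_fps w' e' =
             theta_fps (\<lambda>(i, j). w i * w' j) (\<lambda>(i, j). e i + e' j)"
proof (rule fps_ext)
  fix n
  have "fps_nth (theta_fps w e * theta_fps w' e') n =
          (\<Sum>i | e i \<le> n. \<Sum>j | e' j = n - e i. w i * w' j)"
    by (simp add: theta_fps_mult_nth assms) (simp add: theta_fps_nth sum_distrib_left)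
  also have "\<dots> = (\<Sum>(i, j)\<in>(SIGMA i:{i. e i \<le> n}. {j. e' j = n - e i}). w i * w' j)"
    by (rule sum.Sigma) (auto intro: finite_fibres_atMost assms)
  also have "(SIGMA i:{i. e i \<le> n}. {j. e' j = n - e i}) = {x. (case x of (i, j) \<Rightarrow> e i + e' j) = n}"
    by auto
  finally show "fps_nth (theta_fps w e * theta_fps w' e') n =
                fps_nth (theta_fps (\<lambda>(i, j). w i * w' j) (\<lambda>(i, j). e i + e' j)) n"
    by (simp add: theta_fps_nth)
qed

lemma theta_fps_reindex:
  assumes "bij_betw h UNIV UNIV"
  shows   "theta_fps w e = theta_fps (\<lambda>i. w (h i)) (\<lambda>i. e (h i))"
proof (rule fps_ext)
  fix n
  have "bij_betw h {i. e (h i) = n} {i. e i = n}"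
    using assms by (auto simp: bij_betw_def inj_on_def image_iff surj_def)
  from sum.reindex_bij_betw[OF this, of w]
  show "fps_nth (theta_fps w e) n = fps_nth (theta_fps (\<lambda>i. w (h i)) (\<lambda>i. e (h i))) n"
    by (simp add: theta_fps_nth)
qed

lemma theta_fps_add: "theta_fps w e + theta_fps w' e = theta_fps (\<lambda>i. w i + w' i) e"
  by (rule fps_ext) (simp add: theta_fps_nth sum.distrib)

lemma theta_fps_diff: "theta_fps w e - theta_fps w' e = theta_fps (\<lambda>i. w i - w' i) e"
  by (rule fps_ext) (simp add: theta_fps_nth sum_subtractf)

lemma theta_fps_cmult: "fps_const c * theta_fps w e = theta_fps (\<lambda>i. c * w i) e"
  by (rule fps_ext) (simp add: theta_fps_nth sum_distrib_left)

lemma theta_fps_deriv: "fps_X * fps_deriv (theta_fps w e) = theta_fps (\<lambda>i. of_nat (e i) * w i) e"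
proof (rule fps_ext)
  fix n
  show "fps_nth (fps_X * fps_deriv (theta_fps w e)) n =
        fps_nth (theta_fps (\<lambda>i. of_nat (e i) * w i) e) n"
    by (cases n) (auto simp: theta_fps_nth sum_distrib_left intro!: sum.cong)
qed

lemma theta_fps_compose_X_power:
  assumes "d > 0"
  shows   "theta_fps w e oo fps_X ^ d = theta_fps w (\<lambda>i. d * e i)"
proof (rule fps_ext)
  fix n
  have "{i. d * e i = n} = (if d dvd n then {i. e i = n div d} else {})"
    using assms by auto
  thus "fps_nth (theta_fps w e oo fps_X ^ d) n = fps_nth (theta_fps w (\<lambda>i. d * e i)) n"
    by (simp add: theta_fps_nth fps_nth_compose_X_power)
qed

lemma theta_fps_compose_minus_X:
  "theta_fps w e oo (- fps_X) = theta_fps (\<lambda>i. (-1) ^ e i * w i) e"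
proof (rule fps_ext)
  fix n
  have "fps_nth (theta_fps w e oo (- fps_X)) n = (-1) ^ n * fps_nth (theta_fps w e) n"
    by (simp add: fps_compose_uminus')
  thus "fps_nth (theta_fps w e oo (- fps_X)) n = fps_nth (theta_fps (\<lambda>i. (-1) ^ e i * w i) e) n"
    by (simp add: theta_fps_nth sum_distrib_left)
qed

text \<open>Only the finitely many indices with \<open>e i \<le> N\<close> affect the coefficient at
  \<open>N\<close>; eventually they all lie in \<open>I n\<close> and the relevant coefficients of
  \<open>g n i\<close> agree with those of \<open>G\<close>. This passes from finite sums weighted
  by Gaussian binomials to theta series.\<close>

lemma tendsto_theta_fps:
  fixes g :: "nat \<Rightarrow> 'i \<Rightarrow> 'a::comm_ring_1 fps"
  assumes fin: "\<And>n. finite {i. e i = n}"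
      and I: "\<And>n. finite (I n)" "\<And>i. eventually (\<lambda>n. i \<in> I n) sequentially"
      and g: "\<And>i. (\<lambda>n. g n i) \<longlonglongrightarrow> G"
  shows "(\<lambda>n. \<Sum>i\<in>I n. fps_const (w i) * fps_X ^ e i * g n i) \<longlonglongrightarrow> theta_fps w e * G"
proof (rule tendsto_fpsI)
  fix N
  let ?A = "{i. e i \<le> N}"
  have A: "finite ?A" by (intro finite_fibres_atMost fin)
  have "eventually (\<lambda>n. \<forall>i\<in>?A. i \<in> I n) sequentially"
    using A I(2) by (intro eventually_ball_finite) auto
  moreover have "eventually (\<lambda>n. \<forall>i\<in>?A. fps_nth (g n i) (N - e i) = fps_nth G (N - e i)) sequentially"
    using A g by (intro eventually_ball_finite) (auto simp: tendsto_fps_iff)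
  ultimately show "eventually (\<lambda>n. fps_nth (\<Sum>i\<in>I n. fps_const (w i) * fps_X ^ e i * g n i) N =
                      fps_nth (theta_fps w e * G) N) sequentially"
  proof eventually_elim
    case (elim n)
    have "fps_nth (\<Sum>i\<in>I n. fps_const (w i) * fps_X ^ e i * g n i) N =
          (\<Sum>i\<in>I n. if e i \<le> N then w i * fps_nth (g n i) (N - e i) else 0)"
      by (simp add: fps_sum_nth mult.assoc fps_X_power_mult_nth not_less cong: if_cong)
         (intro sum.cong, auto)
    also have "\<dots> = (\<Sum>i\<in>?A. w i * fps_nth (g n i) (N - e i))"
      using elim(1) I(1) by (intro sum.mono_neutral_cong_right) auto
    also have "\<dots> = fps_nth (theta_fps w e * G) N"
      using elim(2) by (simp add: theta_fps_mult_nth fin)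
    finally show ?case .
  qed
qed

subsection \<open>Gaussian binomial coefficients\<close>

text \<open>The q-Pascal rule, unlike a quotient of q-factorials, makes sense in every commutative
  ring.\<close>

fun gauss_binom :: "'a::comm_ring_1 \<Rightarrow> nat \<Rightarrow> nat \<Rightarrow> 'a" where
  "gauss_binom q n 0 = 1"
| "gauss_binom q 0 (Suc k) = 0"
| "gauss_binom q (Suc n) (Suc k) = gauss_binom q n k + q ^ Suc k * gauss_binom q n (Suc k)"

lemma gauss_binom_eq_0 [simp]: "n < k \<Longrightarrow> gauss_binom q n k = 0"
  by (induction q n k rule: gauss_binom.induct) auto

lemma triangle_Suc: "Suc k * k div 2 = k * (k - 1) div 2 + (k::nat)"
  by (cases k) auto

text \<open>Rothe's q-binomial theorem in homogeneous form. Splitting off the factor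
  \<open>j = 0\<close> leaves the product for \<open>n\<close> with \<open>x * q\<close> in place of
  \<open>x\<close>, hence the arbitrary \<open>x\<close> in the induction; the q-Pascal rule
  recombines the two sums.\<close>

theorem gauss_binomial_theorem:
  fixes q x y :: "'a::comm_ring_1"
  shows "(\<Prod>j<n. y + x * q ^ j) =
           (\<Sum>k\<le>n. q ^ (k * (k - 1) div 2) * gauss_binom q n k * x ^ k * y ^ (n - k))"
proof (induction n arbitrary: x)
  case (Suc n)
  define a where "a = (\<lambda>k. q ^ (k * (k - 1) div 2) * gauss_binom q n k * (x * q) ^ k)"
  have a_Suc: "a (Suc n) = 0" by (simp add: a_def)
  have "(\<Prod>j<Suc n. y + x * q ^ j) = (y + x) * (\<Prod>j<n. y + (x * q) * q ^ j)"
    by (subst prod.lessThan_Suc_shift) (simp add: mult_ac)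
  also have "\<dots> = y * (\<Sum>k\<le>n. a k * y ^ (n - k)) + x * (\<Sum>k\<le>n. a k * y ^ (n - k))"
    unfolding Suc.IH a_def by (rule distrib_right)
  also have "\<dots> = (\<Sum>k\<le>n. a k * y ^ (Suc n - k)) + (\<Sum>k\<le>n. x * a k * y ^ (n - k))"
    unfolding sum_distrib_left
    by (intro arg_cong2[of _ _ _ _ "(+)"] sum.cong refl) (simp_all add: Suc_diff_le mult_ac)
  also have "(\<Sum>k\<le>n. a k * y ^ (Suc n - k)) = (\<Sum>k\<le>Suc n. a k * y ^ (Suc n - k))"
    by (simp add: a_Suc)
  also have "\<dots> = y ^ Suc n + (\<Sum>k\<le>n. a (Suc k) * y ^ (n - k))"
    by (subst sum.atMost_Suc_shift) (simp add: a_def)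
  also have "\<dots> + (\<Sum>k\<le>n. x * a k * y ^ (n - k)) =
             y ^ Suc n + (\<Sum>k\<le>n. q ^ (Suc k * k div 2) * gauss_binom q (Suc n) (Suc k) * x ^ Suc k * y ^ (n - k))"
  proof -
    have "a (Suc k) + x * a k = q ^ (Suc k * k div 2) * gauss_binom q (Suc n) (Suc k) * x ^ Suc k" for k
      unfolding a_def diff_Suc_1 triangle_Suc gauss_binom.simps power_add power_mult_distrib power_Suc
      by (simp only: algebra_simps)
    hence "(a (Suc k) + x * a k) * y ^ (n - k) =
             q ^ (Suc k * k div 2) * gauss_binom q (Suc n) (Suc k) * x ^ Suc k * y ^ (n - k)" for k
      by simp
    thus ?thesis
      unfolding add.assoc sum.distrib [symmetric] distrib_right by simp
  qed
  finally show ?case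
    by (subst sum.atMost_Suc_shift) simp
qed auto

definition qpoch :: "'a::comm_ring_1 \<Rightarrow> nat \<Rightarrow> 'a" where
  "qpoch q n = (\<Prod>j<n. 1 - q ^ Suc j)"

lemma qpoch_0 [simp]: "qpoch q 0 = 1"
  and qpoch_Suc: "qpoch q (Suc n) = (1 - q ^ Suc n) * qpoch q n"
  by (simp_all add: qpoch_def mult.commute)

lemma gauss_binom_self [simp]: "gauss_binom q n n = 1"
  by (induction n) auto

text \<open>The q-factorial formula, multiplied out because \<open>qpoch q n\<close> need not be
  invertible. The induction rests on
  \<open>1 - q ^ (a + b) = (1 - q ^ a) + q ^ a * (1 - q ^ b)\<close>.\<close>

lemma gauss_binom_qpoch:
  "gauss_binom q (a + b) a * qpoch q a * qpoch q b = qpoch q (a + b)"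
proof (induction "a + b" arbitrary: a b)
  case (Suc n)
  show ?case
  proof (cases "a = 0 \<or> b = 0")
    case False
    then obtain a' b' where [simp]: "a = Suc a'" "b = Suc b'"
      by (auto simp: gr0_conv_Suc)
    have *: "gauss_binom q (a' + b) a' * qpoch q a' * qpoch q b = qpoch q (a' + b)"
            "gauss_binom q (a + b') a * qpoch q a * qpoch q b' = qpoch q (a + b')"
      using Suc.hyps(2) by (intro Suc.hyps(1); simp)+
    have "gauss_binom q (a + b) a * qpoch q a * qpoch q b =
          (1 - q ^ a) * (gauss_binom q (a' + b) a' * qpoch q a' * qpoch q b) +
          q ^ a * (1 - q ^ b) * (gauss_binom q (a + b') a * qpoch q a * qpoch q b')"
      by (simp add: qpoch_Suc algebra_simps)
    also have "\<dots> = (1 - q ^ (a + b)) * qpoch q (a' + b)"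
      unfolding * by (simp add: algebra_simps power_add)
    also have "\<dots> = qpoch q (a + b)"
      by (simp add: qpoch_Suc)
    finally show ?thesis .
  qed auto
qed auto

subsection \<open>Euler's product\<close>

text \<open>The infinite product of all \<open>1 - q ^ j\<close>, read off along the diagonal:
  factors after the \<open>n\<close>-th leave the coefficient at \<open>n\<close> unchanged.\<close>

definition euler_fps :: "rat fps" where
  "euler_fps = Abs_fps (\<lambda>n. fps_nth (qpoch fps_X n) n)"

lemma tendsto_qpoch: "qpoch (fps_X :: rat fps) \<longlonglongrightarrow> euler_fps"
proof (rule tendsto_fpsI)
  fix n
  have "fps_nth (qpoch (fps_X :: rat fps) N) n = fps_nth euler_fps n" if "n \<le> N" for N
    using that
  proof (induction rule: dec_induct)
    case (step N)
    have "qpoch (fps_X :: rat fps) (Suc N) = qpoch fps_X N - fps_X ^ Suc N * qpoch fps_X N"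
      by (simp add: qpoch_Suc algebra_simps)
    thus ?case
      using step by (simp only: fps_sub_nth fps_X_power_mult_nth) simp
  qed (simp add: euler_fps_def)
  thus "eventually (\<lambda>N. fps_nth (qpoch (fps_X :: rat fps) N) n = fps_nth euler_fps n) sequentially"
    using eventually_ge_at_top by (rule eventually_mono[rotated])
qed

lemma qpoch_fps_X_nth_0 [simp]: "fps_nth (qpoch (fps_X ^ d :: rat fps) n) 0 = (if d = 0 \<and> n > 0 then 0 else 1)"
  by (induction n) (auto simp: qpoch_Suc power_mult[symmetric])

lemma euler_fps_nth_0 [simp]: "fps_nth euler_fps 0 = 1"
  by (simp add: euler_fps_def)

lemma qpoch_compose:
  assumes "fps_nth h 0 = 0"
  shows "qpoch (fps_X :: rat fps) n oo h = qpoch h n"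
  using assms
  by (simp add: qpoch_def fps_compose_prod_distrib fps_compose_sub_distrib fps_X_power_compose del: power_Suc)

lemma tendsto_qpoch_X_power:
  "d > 0 \<Longrightarrow> qpoch (fps_X ^ d) \<longlonglongrightarrow> (euler_fps oo fps_X ^ d)"
  using tendsto_fps_compose[OF tendsto_qpoch, of "fps_X ^ d"] by (simp add: qpoch_compose)

text \<open>By \<open>gauss_binom_qpoch\<close> this is a quotient with one \<open>qpoch\<close>
  above and two below, and all three tend to the same Euler product.\<close>

lemma tendsto_gauss_binom:
  assumes "filterlim a at_top sequentially" "filterlim b at_top sequentially" "d > 0"
  shows "(\<lambda>n. gauss_binom (fps_X ^ d) (a n + b n) (a n)) \<longlonglongrightarrow> inverse (euler_fps oo fps_X ^ d)"
proof -
  let ?q = "fps_X ^ d :: rat fps" and ?E = "euler_fps oo fps_X ^ d"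
  note lim = tendsto_qpoch_X_power[OF assms(3)]
  have unit: "fps_nth ?E 0 \<noteq> 0"
    by simp
  have "fps_nth (qpoch ?q n) 0 \<noteq> 0" for n
    using assms(3) by auto
  hence nz: "qpoch ?q n * inverse (qpoch ?q n) = 1" for n
    by (rule inverse_mult_eq_1')
  have inv: "(\<lambda>n. inverse (qpoch ?q n)) \<longlonglongrightarrow> inverse ?E"
    by (rule tendsto_inverse_fps[OF lim unit])
  have "filterlim (\<lambda>n. a n + b n) at_top sequentially"
    using assms(1) by (rule filterlim_at_top_mono) auto
  hence "(\<lambda>n. qpoch ?q (a n + b n) * (inverse (qpoch ?q (a n)) * inverse (qpoch ?q (b n))))
          \<longlonglongrightarrow> ?E * (inverse ?E * inverse ?E)"
    by (intro tendsto_fps_mult filterlim_compose[OF lim] filterlim_compose[OF inv] assms)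
  also have "?E * (inverse ?E * inverse ?E) = inverse ?E"
    using inverse_mult_eq_1'[OF unit] by (simp add: mult.assoc[symmetric])
  also have "(\<lambda>n. qpoch ?q (a n + b n) * (inverse (qpoch ?q (a n)) * inverse (qpoch ?q (b n)))) =
             (\<lambda>n. gauss_binom ?q (a n + b n) (a n))"
  proof
    fix n
    let ?G = "gauss_binom ?q (a n + b n) (a n)"
    have "qpoch ?q (a n + b n) * (inverse (qpoch ?q (a n)) * inverse (qpoch ?q (b n))) =
          ?G * (qpoch ?q (a n) * inverse (qpoch ?q (a n))) * (qpoch ?q (b n) * inverse (qpoch ?q (b n)))"
      unfolding gauss_binom_qpoch[symmetric] by (simp only: mult_ac)
    thus "qpoch ?q (a n + b n) * (inverse (qpoch ?q (a n)) * inverse (qpoch ?q (b n))) = ?G"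
      by (simp only: nz mult_1_right)
  qed
  finally show ?thesis .
qed

subsection \<open>The identities of Gauss and Jacobi\<close>

definition parity_sign :: "int \<Rightarrow> rat" where
  "parity_sign i = (if even i then 1 else -1)"

definition triangle :: "int \<Rightarrow> nat" where
  "triangle i = nat (i * (i + 1) div 2)"

lemma int_triangle: "2 * int (triangle i) = i * (i + 1)"
proof -
  have "even (i * (i + 1))" by simp
  moreover have "i * (i + 1) \<ge> 0"
    by (cases "i \<ge> 0") (auto intro: mult_nonpos_nonpos)
  ultimately show ?thesis by (simp add: triangle_def)
qed

lemma triangle_reflect: "triangle (- 1 - i) = triangle i"
  by (simp add: triangle_def algebra_simps)

lemma finite_triangle: "finite {i. triangle i = n}"
proof (rule finite_subset)
  have bound: "\<bar>i\<bar> \<le> 2 * int (triangle i) + 1" for i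
  proof -
    have "i * (i + 1) \<ge> i" using zero_le_square[of i] by (simp add: algebra_simps)
    moreover have "i * (i + 1) \<ge> -i - 1" using zero_le_square[of "i + 1"] by (simp add: algebra_simps)
    ultimately show ?thesis unfolding int_triangle by linarith
  qed
  show "{i. triangle i = n} \<subseteq> {- (2 * int n + 1)..2 * int n + 1}"
  proof
    fix i assume "i \<in> {i. triangle i = n}"
    thus "i \<in> {- (2 * int n + 1)..2 * int n + 1}" using bound[of i] by auto
  qed
qed auto

lemma finite_square: "finite {i::int. nat (i ^ 2) = n}"
proof (rule finite_subset)
  have "\<bar>i\<bar> \<le> i ^ 2" for i :: int
  proof -
    have "\<bar>i\<bar> * 1 \<le> \<bar>i\<bar> * \<bar>i\<bar>"
      by (cases "i = 0", simp, rule mult_left_mono) auto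
    thus ?thesis by (simp add: power2_eq_square)
  qed
  thus "{i::int. nat (i ^ 2) = n} \<subseteq> {- int n..int n}"
    by (auto simp: abs_le_iff) (smt (verit) zero_le_power2)+
qed auto

lemma two_triangle_nat: "2 * (k * (k - 1) div 2) = k * (k - 1)" for k :: nat
proof -
  have "even (k * (k - 1))" by auto
  thus ?thesis by simp
qed

text \<open>Completes the square in the exponents coming from the q-binomial theorem: apart from a
  fixed power, only the distance of \<open>k\<close> from the central index \<open>n\<close>
  matters.\<close>

lemma triangle_shift:
  assumes "k \<le> 2 * n"
  shows "k * (k - 1) div 2 + n * (2 * n - k) =
           (n * (n - 1) div 2 + n * n) + triangle (int n - int k)"
proof -
  have *: "2 * int (k * (k - 1) div 2) = int k * (int k - 1)" for k
  proof -
    have "2 * int (k * (k - 1) div 2) = int (k * (k - 1))"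
      by (subst two_triangle_nat[symmetric]) simp
    thus ?thesis by (cases k) (simp_all add: algebra_simps)
  qed
  have "2 * int (k * (k - 1) div 2 + n * (2 * n - k)) =
        2 * int ((n * (n - 1) div 2 + n * n) + triangle (int n - int k))"
    unfolding of_nat_add distrib_left * int_triangle using assms
    by (simp add: of_nat_diff algebra_simps)
  thus ?thesis by (simp only: mult_cancel_left of_nat_eq_iff) simp
qed

lemma prod_fps_X_power_lessThan:
  "(\<Prod>j<n. (fps_X :: 'a::comm_ring_1 fps) ^ j) = fps_X ^ (n * (n - 1) div 2)"
proof (induction n)
  case (Suc n)
  thus ?case using triangle_Suc[of n] by (simp add: power_add)
qed auto

lemma prod_lessThan_add:
  "(\<Prod>j<a + b. f j) = (\<Prod>j<a. f j) * (\<Prod>j<b. f (a + j :: nat))"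
  by (induction b) (simp_all add: mult.assoc)

lemma prod_reflect_lessThan: "(\<Prod>j<n. f (n - j)) = (\<Prod>j<n. f (Suc j))" for f :: "nat \<Rightarrow> 'a::comm_monoid_mult"
  using prod.nat_diff_reindex[of "\<lambda>j. f (Suc j)" n] by (simp add: Suc_diff_Suc cong: prod.cong_simp)

text \<open>Once \<open>n\<close> is at least \<open>\<bar>i\<bar>\<close>, the truncation by
  \<open>nat\<close> has no effect and the two lower parts \<open>n - i\<close> and
  \<open>n + i + c\<close> add up to \<open>2 * n + c\<close>; both tend to infinity.\<close>

lemma tendsto_gauss_binom_central:
  assumes "d > 0"
  shows "(\<lambda>n. gauss_binom (fps_X ^ d) (2 * n + c) (nat (int n - i)))
           \<longlonglongrightarrow> inverse (euler_fps oo fps_X ^ d)"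
proof (rule Lim_transform_eventually)
  show "(\<lambda>n. gauss_binom (fps_X ^ d) (nat (int n - i) + nat (int n + i + int c)) (nat (int n - i)))
           \<longlonglongrightarrow> inverse (euler_fps oo fps_X ^ d)"
  proof (rule tendsto_gauss_binom[OF _ _ assms])
    have "filterlim (\<lambda>n. n - nat \<bar>i\<bar>) at_top sequentially"
      by (rule filterlim_minus_const_nat_at_top)
    thus "filterlim (\<lambda>n. nat (int n - i)) at_top sequentially"
         "filterlim (\<lambda>n. nat (int n + i + int c)) at_top sequentially"
      by (rule filterlim_at_top_mono, intro always_eventually; linarith)+
  qed
  show "eventually (\<lambda>n. gauss_binom (fps_X ^ d) (nat (int n - i) + nat (int n + i + int c)) (nat (int n - i)) =
           gauss_binom (fps_X ^ d :: rat fps) (2 * n + c) (nat (int n - i))) sequentially"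
    using eventually_ge_at_top[of "nat \<bar>i\<bar>"]
  proof eventually_elim
    case (elim n)
    hence "nat (int n - i) + nat (int n + i + int c) = 2 * n + c" by linarith
    thus ?case by simp
  qed
qed

lemma sum_central_reindex:
  "(\<Sum>k\<le>2 * n. f (int n - int k) k) = (\<Sum>s=-int n..int n. f s (nat (int n - s)))"
  by (rule sum.reindex_bij_witness[of _ "\<lambda>s. nat (int n - s)" "\<lambda>k. int n - int k"]) auto

lemma eventually_mem_central: "eventually (\<lambda>n. i \<in> {-int n - c..int n}) sequentially" if "c \<ge> 0"
  using eventually_ge_at_top[of "nat \<bar>i\<bar>"] by eventually_elim (use that in auto)

section \<open>Gauss's series over squares\<close>

lemma fps_const_parity_sign: "fps_const (parity_sign (int n - int k)) = (-1) ^ n * (-1) ^ k"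
  by (cases "even n"; cases "even k") (simp_all add: parity_sign_def flip: fps_const_neg)

text \<open>The q-binomial theorem for \<open>2 * n\<close> factors with base
  \<open>fps_X ^ 2\<close>, \<open>x = fps_X\<close> and \<open>y = - (fps_X ^ (2 * n))\<close>. The
  first and the last \<open>n\<close> factors each give \<open>?Q\<close> up to sign and a power of
  \<open>fps_X\<close>, and completing the square in the exponents produces
  \<open>(n - k) ^ 2\<close>.\<close>

lemma prod_odd_power_identity:
  "(\<Prod>j<n. 1 - fps_X ^ (2 * j + 1)) ^ 2 =
     (\<Sum>s=-int n..int n. fps_const (parity_sign s) * fps_X ^ nat (s ^ 2) *
        gauss_binom (fps_X ^ 2 :: rat fps) (2 * n) (nat (int n - s)))"
proof -
  let ?X = "fps_X :: rat fps" and ?Q = "\<Prod>j<n. 1 - (fps_X :: rat fps) ^ (2 * j + 1)"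
  have low: "(\<Prod>j<n. ?X ^ (2 * j + 1) - ?X ^ (2 * n)) = ?X ^ (n * n) * ?Q"
  proof -
    have "?X ^ (2 * j + 1) - ?X ^ (2 * n) = ?X ^ (2 * j + 1) * (1 - ?X ^ (2 * (n - j) - 1))" if "j < n" for j
    proof -
      have "2 * n = (2 * j + 1) + (2 * (n - j) - 1)" using that by auto
      hence "?X ^ (2 * n) = ?X ^ (2 * j + 1) * ?X ^ (2 * (n - j) - 1)" by (metis power_add)
      thus ?thesis by (simp only: right_diff_distrib mult_1_right)
    qed
    hence "(\<Prod>j<n. ?X ^ (2 * j + 1) - ?X ^ (2 * n)) =
           (\<Prod>j<n. ?X ^ (2 * j + 1)) * (\<Prod>j<n. 1 - ?X ^ (2 * (n - j) - 1))"
      unfolding prod.distrib[symmetric] by (intro prod.cong) auto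
    also have "(\<Prod>j<n. ?X ^ (2 * j + 1)) = ?X ^ (n * n)"
    proof (induction n)
      case (Suc n)
      have "n * n + (2 * n + 1) = Suc n * Suc n" by simp
      thus ?case unfolding prod.lessThan_Suc Suc.IH power_add[symmetric] by (rule arg_cong)
    qed simp
    also have "(\<Prod>j<n. 1 - ?X ^ (2 * (n - j) - 1)) = ?Q"
      using prod_reflect_lessThan[of "\<lambda>j. 1 - ?X ^ (2 * j - 1)" n] by simp
    finally show ?thesis .
  qed
  have high: "(\<Prod>j<n. ?X ^ (2 * (n + j) + 1) - ?X ^ (2 * n)) = (-1) ^ n * ?X ^ (2 * n * n) * ?Q"
  proof -
    have "?X ^ (2 * (n + j) + 1) - ?X ^ (2 * n) = (- 1) * ?X ^ (2 * n) * (1 - ?X ^ (2 * j + 1))" for j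
      by (simp add: power_add algebra_simps)
    thus ?thesis by (simp only: prod.distrib prod_constant card_lessThan power_mult)
  qed
  have "(\<Prod>j<2 * n. - (?X ^ (2 * n)) + ?X * (?X ^ 2) ^ j) =
        (\<Prod>j<n + n. ?X ^ (2 * j + 1) - ?X ^ (2 * n))"
    unfolding mult_2[of n] by (simp add: power_mult)
  also have "\<dots> = (-1) ^ n * ?X ^ (3 * n * n) * ?Q ^ 2"
  proof -
    have "3 * n * n = n * n + 2 * n * n" by simp
    thus ?thesis
      unfolding prod_lessThan_add low high power2_eq_square by (simp only: power_add mult_ac)
  qed
  finally have "(-1) ^ n * ?X ^ (3 * n * n) * ?Q ^ 2 =
      (\<Sum>k\<le>2 * n. (?X ^ 2) ^ (k * (k - 1) div 2) * gauss_binom (?X ^ 2) (2 * n) k * ?X ^ k *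
         (- (?X ^ (2 * n))) ^ (2 * n - k))"
    by (simp only: gauss_binomial_theorem)
  also have "\<dots> = (-1) ^ n * ?X ^ (3 * n * n) * (\<Sum>k\<le>2 * n. fps_const (parity_sign (int n - int k)) *
         ?X ^ nat ((int n - int k) ^ 2) * gauss_binom (?X ^ 2) (2 * n) k)"
    unfolding sum_distrib_left
  proof (intro sum.cong refl)
    fix k assume "k \<in> {..2 * n}"
    hence k: "k \<le> 2 * n" by simp
    have "k * (k - 1) + k = k * k"
      by (cases k) auto
    moreover have "int (k * k + 2 * n * (2 * n - k)) = int (3 * n * n + nat ((int n - int k) ^ 2))"
      unfolding of_nat_add of_nat_mult of_nat_diff[OF k] by (simp add: power2_eq_square) (simp add: algebra_simps)
    ultimately have "int (k * (k - 1) + k + 2 * n * (2 * n - k)) = int (3 * n * n + nat ((int n - int k) ^ 2))"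
      by simp
    hence e: "k * (k - 1) + k + 2 * n * (2 * n - k) = 3 * n * n + nat ((int n - int k) ^ 2)"
      by (simp only: of_nat_eq_iff)
    have "(- (?X ^ (2 * n))) ^ (2 * n - k) = (-1) ^ (2 * n - k) * ?X ^ (2 * n * (2 * n - k))"
      by (subst power_minus) (simp only: power_mult)
    also have "(-1) ^ (2 * n - k) = ((-1) ^ k :: rat fps)"
      using k by (auto simp: minus_one_power_iff)
    finally have "(?X ^ 2) ^ (k * (k - 1) div 2) * gauss_binom (?X ^ 2) (2 * n) k * ?X ^ k *
         (- (?X ^ (2 * n))) ^ (2 * n - k) =
         (-1) ^ k * ?X ^ (k * (k - 1) + k + 2 * n * (2 * n - k)) * gauss_binom (?X ^ 2) (2 * n) k"
      unfolding power_add power_mult[symmetric] two_triangle_nat by (simp only: mult_ac)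
    also have "\<dots> = (-1) ^ n * ?X ^ (3 * n * n) * (fps_const (parity_sign (int n - int k)) *
         ?X ^ nat ((int n - int k) ^ 2) * gauss_binom (?X ^ 2) (2 * n) k)"
      unfolding e power_add fps_const_parity_sign by (simp add: power_mult_distrib[symmetric] flip: mult.assoc)
    finally show "(?X ^ 2) ^ (k * (k - 1) div 2) * gauss_binom (?X ^ 2) (2 * n) k * ?X ^ k *
         (- (?X ^ (2 * n))) ^ (2 * n - k) = \<dots>" .
  qed
  finally have "?Q ^ 2 = (\<Sum>k\<le>2 * n. fps_const (parity_sign (int n - int k)) *
         ?X ^ nat ((int n - int k) ^ 2) * gauss_binom (?X ^ 2) (2 * n) k)"
    by simp
  also note sum_central_reindex
  finally show ?thesis .
qed

text \<open>Limit of the finite identity after multiplication by the square of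
  \<open>qpoch (fps_X ^ 2) n\<close>, which supplies the even factors missing from
  \<open>Q n\<close>.\<close>

theorem gauss_square_identity:
  "theta_fps parity_sign (\<lambda>s. nat (s ^ 2)) * (euler_fps oo fps_X ^ 2) = euler_fps ^ 2"
proof (rule LIMSEQ_unique)
  let ?X = "fps_X :: rat fps" and ?E = "euler_fps oo fps_X ^ 2"
  define Q where "Q = (\<lambda>n. \<Prod>j<n. 1 - ?X ^ (2 * j + 1))"
  have Q: "Q n * qpoch (?X ^ 2) n = qpoch ?X (2 * n)" for n
  proof (induction n)
    case (Suc n)
    have "Q (Suc n) * qpoch (?X ^ 2) (Suc n) =
          (1 - ?X ^ (2 * n + 1)) * (1 - ?X ^ (2 * Suc n)) * (Q n * qpoch (?X ^ 2) n)"
      unfolding qpoch_Suc power_mult by (simp only: Q_def prod.lessThan_Suc mult_ac)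
    also have "\<dots> = qpoch ?X (2 * Suc n)"
    proof -
      have "qpoch ?X (2 * Suc n) = (1 - ?X ^ (2 * Suc n)) * ((1 - ?X ^ (2 * n + 1)) * qpoch ?X (2 * n))"
        using qpoch_Suc[of ?X "2 * n"] qpoch_Suc[of ?X "Suc (2 * n)"] by (simp del: power_Suc)
      thus ?thesis unfolding Suc.IH by (simp only: mult_ac)
    qed
    finally show ?case .
  qed (simp add: Q_def)
  have "(\<lambda>n. Q n ^ 2) \<longlonglongrightarrow> theta_fps parity_sign (\<lambda>s. nat (s ^ 2)) * inverse ?E"
    unfolding Q_def prod_odd_power_identity
    using tendsto_gauss_binom_central[of 2 0] eventually_mem_central[of 0]
    by (intro tendsto_theta_fps finite_square) auto
  hence "(\<lambda>n. Q n ^ 2 * qpoch (?X ^ 2) n ^ 2)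
           \<longlonglongrightarrow> (theta_fps parity_sign (\<lambda>s. nat (s ^ 2)) * inverse ?E) * ?E ^ 2"
    by (intro tendsto_fps_mult tendsto_fps_power tendsto_qpoch_X_power) auto
  also have "(theta_fps parity_sign (\<lambda>s. nat (s ^ 2)) * inverse ?E) * ?E ^ 2 =
             theta_fps parity_sign (\<lambda>s. nat (s ^ 2)) * ?E * (?E * inverse ?E)"
    by (simp add: power2_eq_square mult_ac)
  also have "?E * inverse ?E = 1"
    by (rule inverse_mult_eq_1') simp
  finally show "(\<lambda>n. qpoch ?X (2 * n) ^ 2) \<longlonglongrightarrow> theta_fps parity_sign (\<lambda>s. nat (s ^ 2)) * ?E"
    by (simp add: power_mult_distrib[symmetric] Q)
  have "filterlim (\<lambda>n::nat. 2 * n) at_top sequentially"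
    by (rule filterlim_at_top_mono[OF filterlim_ident]) auto
  thus "(\<lambda>n. qpoch ?X (2 * n) ^ 2) \<longlonglongrightarrow> euler_fps ^ 2"
    by (intro tendsto_fps_power filterlim_compose[OF tendsto_qpoch])
qed

text \<open>In characteristic 0 a polynomial over power series is determined by its values, which
  \<open>qpoch_square_identity\<close> exploits.\<close>

instance fps :: (ring_char_0) ring_char_0 ..

lemma theta_cancel_euler:
  assumes "d > 0" "\<theta> * inverse (euler_fps oo fps_X ^ d) * (euler_fps oo fps_X ^ d) ^ m = B" "m > 0"
  shows "\<theta> * (euler_fps oo fps_X ^ d) ^ (m - 1) = B"
proof -
  have "inverse (euler_fps oo fps_X ^ d) * (euler_fps oo fps_X ^ d) = 1"
    by (rule inverse_mult_eq_1) simp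
  thus ?thesis using assms by (cases m) (auto simp: mult.assoc mult.left_commute[of \<theta>])
qed

section \<open>Gauss's series over triangular numbers\<close>

text \<open>The q-binomial theorem for \<open>2 * m\<close> factors with \<open>x = 1\<close>,
  \<open>y = fps_X ^ m\<close> and \<open>m = n + 1\<close>. The upper half contains
  \<open>1 + fps_X ^ 0\<close>, the source of the factor 2 and of the unequal lengths of the two
  products.\<close>

lemma prod_triangle_identity:
  "2 * (\<Prod>j<n. 1 + fps_X ^ Suc j) * (\<Prod>j<Suc n. 1 + fps_X ^ Suc j) =
     (\<Sum>s=-int (Suc n)..int (Suc n). fps_const 1 * fps_X ^ triangle s *
        gauss_binom (fps_X ^ 1 :: rat fps) (2 * Suc n) (nat (int (Suc n) - s)))"
proof -
  let ?X = "fps_X :: rat fps"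
  define m where "m = Suc n"
  let ?e = "m * (m - 1) div 2 + m * m"
  have low: "(\<Prod>j<m. ?X ^ m + ?X ^ j) = ?X ^ (m * (m - 1) div 2) * (\<Prod>j<m. 1 + ?X ^ Suc j)"
  proof -
    have "?X ^ m + ?X ^ j = ?X ^ j * (1 + ?X ^ (m - j))" if "j < m" for j
      using that by (simp add: distrib_left power_add[symmetric] add.commute)
    hence "(\<Prod>j<m. ?X ^ m + ?X ^ j) = (\<Prod>j<m. ?X ^ j) * (\<Prod>j<m. 1 + ?X ^ (m - j))"
      unfolding prod.distrib[symmetric] by (intro prod.cong) auto
    thus ?thesis
      by (simp only: prod_fps_X_power_lessThan prod_reflect_lessThan[of "\<lambda>j. 1 + ?X ^ j"])
  qed
  have high: "(\<Prod>j<m. ?X ^ m + ?X ^ (m + j)) = ?X ^ (m * m) * (2 * (\<Prod>j<n. 1 + ?X ^ Suc j))"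
  proof -
    have "(\<Prod>j<m. ?X ^ m + ?X ^ (m + j)) = (\<Prod>j<m. ?X ^ m * (1 + ?X ^ j))"
      by (simp add: power_add algebra_simps)
    also have "\<dots> = ?X ^ (m * m) * (\<Prod>j<Suc n. 1 + ?X ^ j)"
      by (simp only: prod.distrib prod_constant card_lessThan power_mult m_def)
    also have "(\<Prod>j<Suc n. 1 + ?X ^ j) = 2 * (\<Prod>j<n. 1 + ?X ^ Suc j)"
      by (subst prod.lessThan_Suc_shift) simp
    finally show ?thesis .
  qed
  have "?X ^ ?e * (2 * (\<Prod>j<n. 1 + ?X ^ Suc j) * (\<Prod>j<m. 1 + ?X ^ Suc j)) =
        (\<Prod>j<2 * m. ?X ^ m + 1 * ?X ^ j)"
    unfolding mult_2[of m] prod_lessThan_add mult_1 low high unfolding power_add by (simp only: mult_ac)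
  also have "\<dots> = (\<Sum>k\<le>2 * m. ?X ^ (k * (k - 1) div 2 + m * (2 * m - k)) * gauss_binom ?X (2 * m) k)"
    unfolding gauss_binomial_theorem by (simp add: power_add power_mult mult_ac)
  also have "\<dots> = (\<Sum>k\<le>2 * m. ?X ^ (?e + triangle (int m - int k)) * gauss_binom ?X (2 * m) k)"
    by (intro sum.cong refl) (simp only: triangle_shift atMost_iff)
  also have "\<dots> = ?X ^ ?e * (\<Sum>k\<le>2 * m. ?X ^ triangle (int m - int k) * gauss_binom ?X (2 * m) k)"
    by (simp add: power_add sum_distrib_left mult_ac)
  finally have "2 * (\<Prod>j<n. 1 + ?X ^ Suc j) * (\<Prod>j<m. 1 + ?X ^ Suc j) =
                (\<Sum>k\<le>2 * m. ?X ^ triangle (int m - int k) * gauss_binom ?X (2 * m) k)"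
    by simp
  also note sum_central_reindex[of "\<lambda>s k. ?X ^ triangle s * gauss_binom ?X (2 * m) k"]
  finally show ?thesis by (simp add: m_def)
qed

text \<open>Since \<open>(1 + q ^ j) * (1 - q ^ j) = 1 - q ^ (2 * j)\<close>, multiplying the finite
  identity by two Pochhammer products turns its left side into Pochhammer products in
  \<open>fps_X ^ 2\<close>. The 2 reflects that \<open>i\<close> and \<open>- 1 - i\<close> have the
  same triangular number.\<close>

theorem gauss_triangle_identity:
  "theta_fps (\<lambda>_. 1) triangle * euler_fps = 2 * (euler_fps oo fps_X ^ 2) ^ 2"
proof (rule LIMSEQ_unique)
  let ?X = "fps_X :: rat fps" and ?\<theta> = "theta_fps (\<lambda>_. 1) triangle :: rat fps"
  define R where "R = (\<lambda>n. \<Prod>j<n. 1 + ?X ^ Suc j)"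
  have R: "R n * qpoch ?X n = qpoch (?X ^ 2) n" for n
  proof (induction n)
    case (Suc n)
    have "R (Suc n) * qpoch ?X (Suc n) = (1 + ?X ^ Suc n) * (1 - ?X ^ Suc n) * (R n * qpoch ?X n)"
      unfolding qpoch_Suc R_def prod.lessThan_Suc by (simp only: mult_ac)
    also have "(1 + ?X ^ Suc n) * (1 - ?X ^ Suc n) = 1 - (?X ^ 2) ^ Suc n"
      by (simp add: power_mult[symmetric] algebra_simps power_add[symmetric] mult_2 del: power_Suc)
    finally show ?case unfolding Suc.IH qpoch_Suc .
  qed (simp add: R_def)
  define S where "S = (\<lambda>n. \<Sum>s=-int n..int n. fps_const 1 * ?X ^ triangle s *
        gauss_binom (?X ^ 1) (2 * n) (nat (int n - s)))"
  have "S \<longlonglongrightarrow> ?\<theta> * inverse (euler_fps oo ?X ^ 1)"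
    unfolding S_def using tendsto_gauss_binom_central[of 1 0] eventually_mem_central[of 0]
    by (intro tendsto_theta_fps finite_triangle) auto
  hence "(\<lambda>n. S (Suc n) * (qpoch ?X n * qpoch ?X (Suc n)))
           \<longlonglongrightarrow> ?\<theta> * inverse (euler_fps oo ?X ^ 1) * (euler_fps * euler_fps)"
    by (intro tendsto_fps_mult LIMSEQ_Suc tendsto_qpoch)
  also have "?\<theta> * inverse (euler_fps oo ?X ^ 1) * (euler_fps * euler_fps) = ?\<theta> * euler_fps"
    using theta_cancel_euler[of 1 ?\<theta> 2] by (simp add: power2_eq_square)
  also have "(\<lambda>n. S (Suc n) * (qpoch ?X n * qpoch ?X (Suc n))) =
             (\<lambda>n. 2 * (qpoch (?X ^ 2) n * qpoch (?X ^ 2) (Suc n)))"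
    unfolding R[symmetric] S_def prod_triangle_identity[symmetric] by (simp only: R_def mult_ac)
  finally show "(\<lambda>n. 2 * (qpoch (?X ^ 2) n * qpoch (?X ^ 2) (Suc n))) \<longlonglongrightarrow> ?\<theta> * euler_fps" .
  show "(\<lambda>n. 2 * (qpoch (?X ^ 2) n * qpoch (?X ^ 2) (Suc n)))
          \<longlonglongrightarrow> 2 * (euler_fps oo ?X ^ 2) ^ 2"
    unfolding power2_eq_square[of "euler_fps oo ?X ^ 2"]
    by (intro tendsto_fps_mult tendsto_const LIMSEQ_Suc tendsto_qpoch_X_power) auto
qed

section \<open>Jacobi's series for the cube of Euler's product\<close>

lemma gauss_binom_symmetric:
  "gauss_binom (fps_X :: rat fps) (a + b) a = gauss_binom fps_X (a + b) b"
proof -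
  have nz: "qpoch (fps_X :: rat fps) n \<noteq> 0" for n
    using qpoch_fps_X_nth_0[of 1 n] by (auto simp del: qpoch_fps_X_nth_0)
  have "gauss_binom fps_X (a + b) a * (qpoch fps_X a * qpoch fps_X b) =
        gauss_binom (fps_X :: rat fps) (a + b) b * (qpoch fps_X a * qpoch fps_X b)"
    using gauss_binom_qpoch[of "fps_X :: rat fps" a b] gauss_binom_qpoch[of "fps_X :: rat fps" b a]
    by (simp add: mult_ac add.commute)
  thus ?thesis using nz by simp
qed

lemma pderiv_sum_distrib: "pderiv (\<Sum>i\<in>A. f i) = (\<Sum>i\<in>A. pderiv (f i))"
  by (induction A rule: infinite_finite_induct) (simp_all add: pderiv_add)

text \<open>Both sides are the derivative of the polynomial \<open>\<Prod>j<2n+1. y - X ^ j\<close> at its root \<open>y = X ^ n\<close>,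
  up to a sign and a power of \<open>X\<close>.\<close>

lemma qpoch_square_identity:
  "qpoch fps_X n ^ 2 = (\<Sum>k\<le>2 * n. of_nat (2 * n + 1 - k) * (-1) ^ n * (-1) ^ k *
     fps_X ^ triangle (int n - int k) * gauss_binom (fps_X :: rat fps) (2 * n + 1) k)"
proof -
  let ?X = "fps_X :: rat fps" and ?N = "2 * n + 1"
  let ?e = "n * (n - 1) div 2 + n * n"
  define c where "c = (\<lambda>k. ?X ^ (k * (k - 1) div 2) * gauss_binom ?X ?N k * (-1) ^ k)"
  define p where "p = (\<Prod>j<?N. [:- (?X ^ j), 1:])"
  define r where "r = (\<Prod>j\<in>{..<?N} - {n}. [:- (?X ^ j), 1:])"
  have p: "p = (\<Sum>k\<le>?N. Polynomial.monom (c k) (?N - k))"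
  proof -
    have "poly p y = poly (\<Sum>k\<le>?N. Polynomial.monom (c k) (?N - k)) y" for y
      using gauss_binomial_theorem[of y "-1" ?X ?N]
      by (simp add: p_def c_def poly_prod poly_sum poly_monom del: prod.lessThan_Suc)
    thus ?thesis unfolding poly_eq_poly_eq_iff[symmetric] by (rule ext)
  qed
  have "poly (pderiv p) (?X ^ n) =
      (\<Sum>k\<le>?N. of_nat (?N - k) * c k * ?X ^ (n * (?N - k - 1)))"
    unfolding p by (simp only: pderiv_sum_distrib pderiv_monom poly_sum poly_monom power_mult)
  \<comment> \<open>The term \<open>k = 2 * n + 1\<close> has weight 0 and drops out.\<close>
  also have "\<dots> = (\<Sum>k\<le>2 * n. of_nat (?N - k) * c k * ?X ^ (n * (2 * n - k)))"
    by simp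
  also have "\<dots> = (\<Sum>k\<le>2 * n. ?X ^ ?e * (of_nat (?N - k) * (-1) ^ k * ?X ^ triangle (int n - int k) *
                      gauss_binom ?X ?N k))"
  proof (intro sum.cong refl)
    fix k assume "k \<in> {..2 * n}"
    hence "?X ^ (k * (k - 1) div 2) * ?X ^ (n * (2 * n - k)) = ?X ^ ?e * ?X ^ triangle (int n - int k)"
      using triangle_shift[of k n] by (simp only: power_add[symmetric]) simp
    hence "(of_nat (?N - k) * (-1) ^ k * gauss_binom ?X ?N k) *
             (?X ^ (k * (k - 1) div 2) * ?X ^ (n * (2 * n - k))) =
           (of_nat (?N - k) * (-1) ^ k * gauss_binom ?X ?N k) * (?X ^ ?e * ?X ^ triangle (int n - int k))"
      by (rule arg_cong)
    thus "of_nat (?N - k) * c k * ?X ^ (n * (2 * n - k)) =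
          ?X ^ ?e * (of_nat (?N - k) * (-1) ^ k * ?X ^ triangle (int n - int k) * gauss_binom ?X ?N k)"
      unfolding c_def by (simp only: mult_ac)
  qed
  finally have rhs: "poly (pderiv p) (?X ^ n) = ?X ^ ?e * (\<Sum>k\<le>2 * n. of_nat (?N - k) * (-1) ^ k *
      ?X ^ triangle (int n - int k) * gauss_binom ?X ?N k)"
    by (simp only: sum_distrib_left)

  have p': "p = [:- (?X ^ n), 1:] * r"
    unfolding p_def r_def by (subst prod.remove[of _ n]) auto
  \<comment> \<open>At the root, only the product-rule term that differentiates the vanishing linear
    factor survives.\<close>
  have "poly (pderiv p) (?X ^ n) = poly r (?X ^ n)"
    unfolding p' pderiv_mult by (simp add: pderiv_pCons)
  also have "\<dots> = (\<Prod>j\<in>{..<?N} - {n}. ?X ^ n - ?X ^ j)"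
    by (simp add: r_def poly_prod)
  also have "{..<?N} - {n} = {..<n} \<union> {n+1..<?N}" by auto
  also have "(\<Prod>j\<in>\<dots>. ?X ^ n - ?X ^ j) = (\<Prod>j<n. ?X ^ n - ?X ^ j) * (\<Prod>j\<in>{n+1..<?N}. ?X ^ n - ?X ^ j)"
    by (rule prod.union_disjoint) auto
  also have "(\<Prod>j\<in>{n+1..<?N}. ?X ^ n - ?X ^ j) = (\<Prod>j<n. ?X ^ n - ?X ^ (n + Suc j))"
    by (rule prod.reindex_bij_witness[of _ "\<lambda>j. n + Suc j" "\<lambda>j. j - n - 1"]) auto
  also have "\<dots> = (\<Prod>j<n. ?X ^ n * (1 - ?X ^ Suc j))"
    by (simp only: power_add right_diff_distrib mult_1_right)
  also have "\<dots> = ?X ^ (n * n) * qpoch ?X n"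
    by (simp add: prod.distrib qpoch_def power_mult)
  also have "(\<Prod>j<n. ?X ^ n - ?X ^ j) = (\<Prod>j<n. (-1) * ?X ^ j * (1 - ?X ^ (n - j)))"
    by (intro prod.cong refl) (simp add: algebra_simps power_add[symmetric])
  also have "\<dots> = (-1) ^ n * ?X ^ (n * (n - 1) div 2) * qpoch ?X n"
    unfolding prod.distrib prod_fps_X_power_lessThan prod_reflect_lessThan[of "\<lambda>j. 1 - ?X ^ j"] qpoch_def
    by simp
  also have "\<dots> * (?X ^ (n * n) * qpoch ?X n) = ?X ^ ?e * ((-1) ^ n * qpoch ?X n ^ 2)"
    by (simp add: power_add power2_eq_square mult_ac)
  finally have "(-1) ^ n * qpoch ?X n ^ 2 = (\<Sum>k\<le>2 * n. of_nat (?N - k) * (-1) ^ k *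
      ?X ^ triangle (int n - int k) * gauss_binom ?X ?N k)"
    using rhs by simp
  hence "(-1) ^ n * ((-1) ^ n * qpoch ?X n ^ 2) = (\<Sum>k\<le>2 * n. of_nat (?N - k) * (-1) ^ n * (-1) ^ k *
      ?X ^ triangle (int n - int k) * gauss_binom ?X ?N k)"
    by (simp only: sum_distrib_left mult_ac)
  thus ?thesis by (simp flip: mult.assoc power_mult_distrib)
qed

text \<open>\<open>m\<close> and \<open>- 1 - m\<close> share the triangular number and the Gaussian
  binomial but have opposite signs. Adding the sum to its reflection therefore replaces the weight
  \<open>n + 1 + m\<close> by \<open>(n + 1 + m) - (n - m) = 2 * m + 1\<close>.\<close>

lemma two_qpoch_square_identity:
  "2 * qpoch fps_X n ^ 2 = (\<Sum>m=-int n-1..int n. fps_const (parity_sign m * of_int (2 * m + 1)) *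
     fps_X ^ triangle m * gauss_binom (fps_X ^ 1 :: rat fps) (2 * n + 1) (nat (int n - m)))"
proof -
  let ?X = "fps_X :: rat fps" and ?A = "{-int n-1..int n}"
  define g where "g = (\<lambda>m. ?X ^ triangle m * gauss_binom ?X (2 * n + 1) (nat (int n - m)))"
  define f where "f = (\<lambda>m. fps_const (parity_sign m * of_int (int n + 1 + m)) * g m)"
  have g: "g (- 1 - m) = g m" if "m \<in> ?A" for m
  proof -
    have "nat (int n - (- 1 - m)) + nat (int n - m) = 2 * n + 1" using that by auto
    thus ?thesis
      using gauss_binom_symmetric[of "nat (int n - (- 1 - m))" "nat (int n - m)"]
      by (simp add: g_def triangle_reflect)
  qed
  have "qpoch ?X n ^ 2 = (\<Sum>k\<le>2 * n. fps_const (parity_sign (int n - int k)) *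
            fps_const (of_nat (2 * n + 1 - k)) * ?X ^ triangle (int n - int k) * gauss_binom ?X (2 * n + 1) k)"
    unfolding qpoch_square_identity fps_const_parity_sign fps_of_nat by (simp only: mult_ac)
  also have "\<dots> = (\<Sum>k\<le>2 * n. fps_const (parity_sign (int n - int k) * of_int (int n + 1 + (int n - int k))) *
            (?X ^ triangle (int n - int k) * gauss_binom ?X (2 * n + 1) k))"
    by (intro sum.cong refl) (auto simp: of_nat_diff mult.assoc algebra_simps)
  also have "\<dots> = (\<Sum>m=-int n..int n. f m)"
    unfolding f_def g_def
    by (rule sum_central_reindex[of "\<lambda>s k. fps_const (parity_sign s * of_int (int n + 1 + s)) *
              (?X ^ triangle s * gauss_binom ?X (2 * n + 1) k)"])
  \<comment> \<open>The new index \<open>m = - n - 1\<close>, which makes the range invariant under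
    the reflection, has weight 0.\<close>
  also have "\<dots> = (\<Sum>m\<in>?A. f m)"
    by (rule sum.mono_neutral_left) (auto simp: f_def)
  finally have 1: "qpoch ?X n ^ 2 = (\<Sum>m\<in>?A. f m)" .
  also have "(\<Sum>m\<in>?A. f m) = (\<Sum>m\<in>?A. f (- 1 - m))"
    by (rule sum.reindex_bij_witness[of _ "\<lambda>m. -1 - m" "\<lambda>m. -1 - m"]) auto
  finally have "2 * qpoch ?X n ^ 2 = (\<Sum>m\<in>?A. f m + f (- 1 - m))"
    using 1 by (simp add: sum.distrib)
  also have "\<dots> = (\<Sum>m\<in>?A. fps_const (parity_sign m * of_int (2 * m + 1)) * g m)"
  proof (intro sum.cong refl)
    fix m assume m: "m \<in> ?A"
    show "f m + f (- 1 - m) = fps_const (parity_sign m * of_int (2 * m + 1)) * g m"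
      unfolding f_def g[OF m] distrib_right[symmetric] fps_const_add
      by (intro arg_cong2[of _ _ _ _ "(*)"] arg_cong[of _ _ fps_const])
         (auto simp: parity_sign_def algebra_simps)
  qed
  finally show ?thesis by (simp add: g_def mult.assoc)
qed

text \<open>In the limit the Gaussian binomials contribute the inverse of Euler's product, which
  moves to the other side. The 2 is there because a sum over all integers meets each term of
  Jacobi's series twice.\<close>

theorem jacobi_cube_identity:
  "theta_fps (\<lambda>m. parity_sign m * of_int (2 * m + 1)) triangle = 2 * euler_fps ^ 3"
proof -
  let ?X = "fps_X :: rat fps" and ?\<theta> = "theta_fps (\<lambda>m. parity_sign m * of_int (2 * m + 1)) triangle"
  have "(\<lambda>n. 2 * qpoch ?X n ^ 2) \<longlonglongrightarrow> ?\<theta> * inverse (euler_fps oo ?X ^ 1)"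
    unfolding two_qpoch_square_identity
    using tendsto_gauss_binom_central[of 1 1] eventually_mem_central[of 1]
    by (intro tendsto_theta_fps finite_triangle) auto
  moreover have "(\<lambda>n. 2 * qpoch ?X n ^ 2) \<longlonglongrightarrow> 2 * euler_fps ^ 2"
    by (intro tendsto_fps_mult tendsto_const tendsto_fps_power tendsto_qpoch)
  ultimately have "?\<theta> * inverse (euler_fps oo ?X ^ 1) = 2 * euler_fps ^ 2"
    by (rule LIMSEQ_unique)
  thus ?thesis using theta_cancel_euler[of 1 ?\<theta> 1 "2 * euler_fps ^ 3"]
    by (simp add: power3_eq_cube power2_eq_square mult.assoc)
qed

abbreviation euler_power :: "nat \<Rightarrow> rat fps" where
  "euler_power d \<equiv> euler_fps oo fps_X ^ d"

lemma jacobi_cube_identity_power: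
  "d > 0 \<Longrightarrow> theta_fps (\<lambda>m. parity_sign m * of_int (2 * m + 1)) (\<lambda>m. d * triangle m) = 2 * euler_power d ^ 3"
  using arg_cong[OF jacobi_cube_identity, of "\<lambda>F. F oo fps_X ^ d"]
  by (simp add: theta_fps_compose_X_power fps_compose_mult_distrib fps_compose_power)

subsection \<open>The fifth power of the Euler products\<close>

text \<open>For an odd power \<open>u\<close> the factors pair up as
  \<open>(1 + u) * (1 - u) = 1 - u ^ 2\<close>, while the factors with an even power
  \<open>v\<close> occur twice; together with \<open>1 - v ^ 2\<close> from
  \<open>euler_power 4\<close> everything is a factor in \<open>fps_X ^ 2\<close>.\<close>

lemma euler_fps_minus_X:
  "(euler_fps oo - fps_X) * euler_fps * euler_power 4 = euler_power 2 ^ 3"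
proof (rule LIMSEQ_unique)
  let ?X = "fps_X :: rat fps"
  define L where "L = (\<lambda>n. qpoch (- ?X) (2 * n) * qpoch ?X (2 * n) * qpoch (?X ^ 4) n)"
  have dbl: "filterlim (\<lambda>n::nat. 2 * n) at_top sequentially"
    by (rule filterlim_at_top_mono[OF filterlim_ident]) auto
  have "qpoch (- ?X) \<longlonglongrightarrow> (euler_fps oo - ?X)"
    using tendsto_fps_compose[OF tendsto_qpoch, of "- ?X"] by (simp add: qpoch_compose)
  thus "L \<longlonglongrightarrow> (euler_fps oo - ?X) * euler_fps * euler_power 4"
    unfolding L_def
    by (intro tendsto_fps_mult tendsto_qpoch_X_power filterlim_compose[OF _ dbl] tendsto_qpoch) auto
  have double: "qpoch q (2 * Suc n) = (1 - q ^ (2 * n + 2)) * ((1 - q ^ (2 * n + 1)) * qpoch q (2 * n))" for q n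
    using qpoch_Suc[of q "2 * n"] qpoch_Suc[of q "Suc (2 * n)"] by (simp del: power_Suc)
  have L: "L n = qpoch (?X ^ 2) (2 * n) * qpoch (?X ^ 2) n ^ 2" for n
  proof (induction n)
    case (Suc n)
    define u where "u = ?X ^ (2 * n + 1)"
    define v where "v = ?X ^ (2 * n + 2)"
    have pow: "(- ?X) ^ (2 * n + 1) = - u" "(- ?X) ^ (2 * n + 2) = v" "(?X ^ 4) ^ Suc n = v ^ 2"
      "(?X ^ 2) ^ (2 * n + 2) = v ^ 2" "(?X ^ 2) ^ (2 * n + 1) = u ^ 2" "(?X ^ 2) ^ Suc n = v"
      unfolding u_def v_def power_mult[symmetric]
      by (simp, simp) (rule arg_cong[where f = "\<lambda>k. ?X ^ k"], simp)+
    have "L (Suc n) = ((1 - v) * (1 + u)) * ((1 - v) * (1 - u)) * (1 - v ^ 2) * L n"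
      unfolding L_def double qpoch_Suc[of "?X ^ 4"] pow u_def[symmetric] v_def[symmetric]
      by (simp add: algebra_simps)
    also have "\<dots> = qpoch (?X ^ 2) (2 * Suc n) * qpoch (?X ^ 2) (Suc n) ^ 2"
      unfolding Suc.IH double qpoch_Suc[of "?X ^ 2"] pow
      by (simp add: algebra_simps power2_eq_square)
    finally show ?case .
  qed (simp add: L_def)
  have "(\<lambda>n. qpoch (?X ^ 2) (2 * n) * qpoch (?X ^ 2) n ^ 2) \<longlonglongrightarrow> euler_power 2 * euler_power 2 ^ 2"
    by (intro tendsto_fps_mult tendsto_fps_power tendsto_qpoch_X_power filterlim_compose[OF _ dbl] dbl) auto
  hence "L \<longlonglongrightarrow> euler_power 2 * euler_power 2 ^ 2"
    by (simp only: L[symmetric])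
  thus "L \<longlonglongrightarrow> euler_power 2 ^ 3"
    by (simp add: power3_eq_cube power2_eq_square mult.assoc)
qed

lemma theta_fps_bool:
  fixes w :: "'i \<Rightarrow> 'a::comm_ring_1"
  shows "theta_fps (\<lambda>(b::bool, i). w i) (\<lambda>(b, i). e i) = 2 * theta_fps w e"
proof (rule fps_ext)
  fix n
  have "{x. (case x of (b::bool, i) \<Rightarrow> e i) = n} = UNIV \<times> {i. e i = n}" by auto
  hence "fps_nth (theta_fps (\<lambda>(b::bool, i). w i) (\<lambda>(b, i). e i)) n =
           (\<Sum>(b, i)\<in>(UNIV :: bool set) \<times> {i. e i = n}. w i)"
    by (simp only: theta_fps_nth)
  also have "\<dots> = (\<Sum>b\<in>(UNIV :: bool set). \<Sum>i | e i = n. w i)"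
    by (rule sum.cartesian_product[symmetric])
  also have "\<dots> = fps_nth (2 * theta_fps w e) n"
    by (simp add: theta_fps_nth UNIV_bool numeral_fps_const)
  finally show "fps_nth (theta_fps (\<lambda>(b::bool, i). w i) (\<lambda>(b, i). e i)) n = fps_nth (2 * theta_fps w e) n" .
qed

lemma parity_sign_simps [simp]:
  "parity_sign (i + j) = parity_sign i * parity_sign j"
  "parity_sign (i - j) = parity_sign i * parity_sign j"
  "parity_sign i * (parity_sign i * x) = x"
  by (auto simp: parity_sign_def)

lemma parity_sign_nat_square: "(-1) ^ nat (i ^ 2) = parity_sign i"
proof -
  have "even (nat (i ^ 2)) \<longleftrightarrow> even i" by (simp add: even_nat_iff)
  thus ?thesis by (simp add: parity_sign_def minus_one_power_iff)
qed

text \<open>Every pair of integers is uniquely \<open>(r + s, r - s)\<close> or \<open>(r + s, - 1 - (r - s))\<close>, according to the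
  parity of its sum, and \<open>n \<mapsto> - 1 - n\<close> preserves the terms of Jacobi's series.\<close>

lemma bij_sum_difference:
  "bij_betw (\<lambda>(b, r, s). (r + s, if b then r - s else - 1 - (r - s :: int))) UNIV UNIV"
proof (rule bij_betw_byWitness)
  let ?g = "\<lambda>(m, n). if even (m + n) then (True, (m + n) div 2, (m - n) div 2)
                     else (False, (m - n - 1) div 2, (m + n + 1 :: int) div 2)"
  let ?h = "\<lambda>(b, r, s). (r + s, if b then r - s else - 1 - (r - s :: int))"
  show "\<forall>x\<in>UNIV. ?g (?h x) = x"
  proof
    fix x :: "bool \<times> int \<times> int"
    obtain b r s where x: "x = (b, r, s)" by (cases x)
    have "(r + s) + (r - s) = 2 * r" "(r + s) - (r - s) = 2 * s"
         "(r + s) + (- 1 - (r - s)) = 2 * s - 1" "(r + s) - (- 1 - (r - s)) - 1 = 2 * r"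
      by auto
    thus "?g (?h x) = x"
      unfolding x by (cases b) simp_all
  qed
  show "\<forall>x\<in>UNIV. ?h (?g x) = x"
  proof
    fix x :: "int \<times> int"
    obtain m n where x: "x = (m, n)" by (cases x)
    have "?h (?g (m, n)) = (m, n)"
    proof (cases "even (m + n)")
      case True
      then obtain r where r: "m + n = 2 * r" by (elim evenE)
      hence "(m - n) div 2 = r - n" "(m + n) div 2 = r" by simp_all
      with True have "?g (m, n) = (True, r, r - n)" by simp
      thus ?thesis using r by simp
    next
      case False
      then obtain r where r: "m + n = 2 * r + 1" by (elim oddE)
      hence "(m - n - 1) div 2 = r - n" "(m + n + 1) div 2 = r + 1" by presburger+
      with False have "?g (m, n) = (False, r - n, r + 1)" by (simp only: prod.case if_False)
      thus ?thesis using r by simp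
    qed
    thus "?h (?g x) = x" by (simp only: x)
  qed
qed auto

text \<open>Rotating the double sum splits the exponent into \<open>2 * triangle r + s ^ 2\<close>
  and the weight into \<open>(2 * r + 1) ^ 2 - 4 * s ^ 2\<close>, which the operator q d/dq produces
  from \<open>P\<close> and \<open>\<phi>\<close>. The substitution of \<open>- fps_X\<close> leaves
  exactly the sign of \<open>s\<close>, and the two parity classes contribute equally.\<close>

lemma jacobi_square_rearrangement:
  fixes P \<phi> :: "rat fps"
  defines "P \<equiv> theta_fps (\<lambda>_. 1) (\<lambda>r. 2 * triangle r)"
      and "\<phi> \<equiv> theta_fps parity_sign (\<lambda>s. nat (s ^ 2))"
  shows "4 * (euler_fps oo - fps_X) ^ 6 =
           2 * ((P + 4 * (fps_X * fps_deriv P)) * \<phi> - 4 * P * (fps_X * fps_deriv \<phi>))"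
proof -
  let ?w = "\<lambda>m. parity_sign m * of_int (2 * m + 1)"
  let ?h = "\<lambda>(b, r, s). (r + s, if b then r - s else - 1 - (r - s :: int))"
  let ?W = "\<lambda>(m, n). ((-1) ^ triangle m * ?w m) * ((-1) ^ triangle n * ?w n)"
  let ?e = "\<lambda>(m, n). triangle m + triangle n"
  have fin2: "finite {i. 2 * triangle i = n}" for n
    by (rule finite_subset[OF _ finite_triangle[of "n div 2"]]) auto
  have w_reflect: "?w (- 1 - n) = ?w n" for n
    by (auto simp: parity_sign_def algebra_simps)
  have "2 * (euler_fps oo - fps_X) ^ 3 = theta_fps (\<lambda>m. (-1) ^ triangle m * ?w m) triangle"
    using arg_cong[OF jacobi_cube_identity, of "\<lambda>F. F oo - fps_X"]
    by (simp add: theta_fps_compose_minus_X fps_compose_mult_distrib fps_compose_power)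
  hence "(2 * (euler_fps oo - fps_X) ^ 3) ^ 2 = theta_fps ?W ?e"
    by (simp only: power2_eq_square theta_fps_mult finite_triangle)
  also have "\<dots> = theta_fps (\<lambda>x. ?W (?h x)) (\<lambda>x. ?e (?h x))"
    by (rule theta_fps_reindex[OF bij_sum_difference])
  also have "(\<lambda>x. ?e (?h x)) = (\<lambda>(b, r, s). 2 * triangle r + nat (s ^ 2))"
  proof
    fix x :: "bool \<times> int \<times> int"
    obtain b r s where x: "x = (b, r, s)" by (cases x)
    have "2 * int (triangle (r + s) + triangle (r - s)) = 2 * int (2 * triangle r + nat (s ^ 2))"
      unfolding of_nat_add distrib_left of_nat_mult of_nat_numeral int_triangle
      by (simp add: power2_eq_square algebra_simps)
    hence "triangle (r + s) + triangle (r - s) = 2 * triangle r + nat (s ^ 2)"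
      by (simp only: mult_cancel_left of_nat_eq_iff) simp
    thus "?e (?h x) = (case x of (b, r, s) \<Rightarrow> 2 * triangle r + nat (s ^ 2))"
      by (simp add: x triangle_reflect)
  qed
  also have "(\<lambda>x. ?W (?h x)) =
               (\<lambda>(b, r, s). parity_sign s * (1 + 4 * of_nat (2 * triangle r) - 4 * of_nat (nat (s ^ 2))))"
  proof
    fix x :: "bool \<times> int \<times> int"
    obtain b r s where x: "x = (b, r, s)" by (cases x)
    have "2 * int (triangle (r + s) + triangle (r - s)) = 2 * int (2 * triangle r + nat (s ^ 2))"
      unfolding of_nat_add distrib_left of_nat_mult of_nat_numeral int_triangle
      by (simp add: power2_eq_square algebra_simps)
    hence e: "triangle (r + s) + triangle (r - s) = 2 * triangle r + nat (s ^ 2)"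
      by (simp only: mult_cancel_left of_nat_eq_iff) simp
    have "(-1) ^ triangle (r + s) * (-1) ^ triangle (r - s) = (parity_sign s :: rat)"
      unfolding power_add[symmetric] e by (simp add: power_add power_mult parity_sign_nat_square)
    moreover have "?w (r + s) * ?w (r - s) = of_int (1 + 4 * (2 * int (triangle r)) - 4 * s ^ 2)"
      unfolding int_triangle by (simp add: parity_sign_def power2_eq_square algebra_simps)
    ultimately have "((-1) ^ triangle (r + s) * ?w (r + s)) * ((-1) ^ triangle (r - s) * ?w (r - s)) =
          parity_sign s * (1 + 4 * of_nat (2 * triangle r) - 4 * of_nat (nat (s ^ 2)))"
      by (simp add: mult_ac)
    thus "?W (?h x) = (case x of (b, r, s) \<Rightarrow>
            parity_sign s * (1 + 4 * of_nat (2 * triangle r) - 4 * of_nat (nat (s ^ 2))))"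
      unfolding x by (cases b) (simp_all only: prod.case w_reflect triangle_reflect if_True if_False)
  qed
  also have "theta_fps (\<lambda>(b, r, s). parity_sign s * (1 + 4 * of_nat (2 * triangle r) - 4 * of_nat (nat (s ^ 2))))
               (\<lambda>(b::bool, r, s). 2 * triangle r + nat (s ^ 2)) =
             2 * theta_fps (\<lambda>(r, s). parity_sign s * (1 + 4 * of_nat (2 * triangle r) - 4 * of_nat (nat (s ^ 2))))
               (\<lambda>(r, s). 2 * triangle r + nat (s ^ 2))"
    using theta_fps_bool[of "\<lambda>(r, s). parity_sign s * (1 + 4 * of_nat (2 * triangle r) - 4 * of_nat (nat (s ^ 2)))"
        "\<lambda>(r, s). 2 * triangle r + nat (s ^ 2)"] by simp
  also have "theta_fps (\<lambda>(r, s). parity_sign s * (1 + 4 * of_nat (2 * triangle r) - 4 * of_nat (nat (s ^ 2))))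
               (\<lambda>(r, s). 2 * triangle r + nat (s ^ 2)) =
             (P + fps_const 4 * (fps_X * fps_deriv P)) * \<phi> - P * (fps_const 4 * (fps_X * fps_deriv \<phi>))"
    unfolding P_def \<phi>_def theta_fps_deriv theta_fps_cmult theta_fps_add
    by (subst (1 2) theta_fps_mult)
       (auto simp: theta_fps_diff fin2[unfolded mult.commute[of 2]] fin2 finite_square algebra_simps split_def
             intro!: arg_cong2[of _ _ _ _ theta_fps])
  finally show ?thesis
    by (simp add: power_mult_distrib numeral_fps_const[symmetric] mult_ac flip: power_mult)
qed

lemma fps_X_mult_deriv_mult:
  "fps_X * fps_deriv (f * g) = fps_X * fps_deriv f * g + f * (fps_X * fps_deriv g)" for f g :: "'a::comm_ring_1 fps"
  by (simp add: algebra_simps)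

lemma fps_X_mult_deriv_power:
  "fps_X * fps_deriv (f ^ n) = of_nat n * f ^ (n - 1) * (fps_X * fps_deriv f)" for f :: "'a::comm_ring_1 fps"
  by (simp add: fps_deriv_power mult_ac flip: fps_of_nat)

text \<open>Gauss's identities express \<open>P * b\<close> and \<open>\<phi> * b\<close> through
  \<open>c ^ 2\<close> and \<open>a ^ 2\<close>. After multiplication by \<open>b ^ 2\<close> the
  derivatives of \<open>b\<close> cancel in the Wronskian.\<close>

lemma gauss_wronskian_identity:
  "(euler_fps oo - fps_X) ^ 6 * euler_power 2 ^ 2 =
     euler_fps * euler_power 4 *
       (euler_fps * euler_power 4 + 8 * euler_fps * (fps_X * fps_deriv (euler_power 4))
          - 8 * euler_power 4 * (fps_X * fps_deriv euler_fps))"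
proof -
  define a b c where "a = euler_fps" "b = euler_power 2" "c = euler_power 4"
  define D :: "rat fps \<Rightarrow> rat fps" where "D = (\<lambda>f. fps_X * fps_deriv f)"
  define P :: "rat fps" where "P = theta_fps (\<lambda>_. 1) (\<lambda>r. 2 * triangle r)"
  define \<phi> where "\<phi> = theta_fps parity_sign (\<lambda>s. nat (s ^ 2))"
  have "(theta_fps (\<lambda>_. 1) triangle oo fps_X ^ 2) * b = 2 * (euler_power 2 oo fps_X ^ 2) ^ 2"
    using arg_cong[OF gauss_triangle_identity, of "\<lambda>F. F oo fps_X ^ 2"]
    by (simp add: a_b_c_def fps_compose_mult_distrib fps_compose_power)
  also have "euler_power 2 oo fps_X ^ 2 = c"
    by (simp add: a_b_c_def fps_compose_assoc[symmetric] fps_X_power_compose flip: power_mult)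
  finally have P: "P * b = 2 * c ^ 2"
    by (simp add: P_def theta_fps_compose_X_power)
  have \<phi>: "\<phi> * b = a ^ 2"
    using gauss_square_identity by (simp add: \<phi>_def a_b_c_def)
  have D_mult: "D (f * g) = D f * g + f * D g" and D_square: "D (f ^ 2) = 2 * f * D f" for f g
    using fps_X_mult_deriv_mult[of f g] fps_X_mult_deriv_power[of f 2] by (simp_all add: D_def)
  have "D 2 = 0" by (simp add: D_def)
  hence DP: "D P * b = 4 * c * D c - P * D b"
    using arg_cong[OF P, of D] unfolding D_mult D_square by (simp add: algebra_simps)
  have D\<phi>: "D \<phi> * b = 2 * a * D a - \<phi> * D b"
    using arg_cong[OF \<phi>, of D] unfolding D_mult D_square by (simp add: algebra_simps)
  have "4 * ((euler_fps oo - fps_X) ^ 6 * b ^ 2) =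
          2 * ((P + 4 * D P) * \<phi> - 4 * P * D \<phi>) * b ^ 2"
    unfolding P_def \<phi>_def D_def jacobi_square_rearrangement[symmetric] by (simp only: mult_ac)
  also have "\<dots> = 2 * ((P * b) * (\<phi> * b) + 4 * (D P * b) * (\<phi> * b) - 4 * (P * b) * (D \<phi> * b))"
    by (simp add: algebra_simps power2_eq_square)
  also have "\<dots> = 2 * ((P * b) * (\<phi> * b) + 16 * c * D c * (\<phi> * b) - 8 * (P * b) * a * D a)"
    unfolding DP D\<phi> by (simp add: algebra_simps)
  also have "\<dots> = 4 * (a * c * (a * c + 8 * a * D c - 8 * c * D a))"
    unfolding P \<phi> by (simp add: algebra_simps power2_eq_square)
  finally show ?thesis
    by (simp add: a_b_c_def D_def)
qed

text \<open>As \<open>8 * triangle m + 1 = (2 * m + 1) ^ 2\<close>, the theta series is the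
  combination \<open>W\<close> of Jacobi's series \<open>A\<close>, \<open>B\<close> and their
  derivatives. Expanding \<open>W\<close> leaves the bracket of
  \<open>gauss_wronskian_identity\<close>.\<close>

theorem euler_fifth_power_theta:
  "theta_fps (\<lambda>(m, n). parity_sign m * parity_sign n * of_int ((2 * m + 1) * (2 * n + 1) *
       ((2 * m + 1) ^ 2 - 4 * (2 * n + 1) ^ 2))) (\<lambda>(m, n). triangle m + 4 * triangle n) =
   - 12 * ((euler_fps * euler_power 2) ^ 5 oo - fps_X)"
proof -
  define a b c where "a = euler_fps" "b = euler_power 2" "c = euler_power 4"
  define g where "g = euler_fps oo - fps_X"
  define D :: "rat fps \<Rightarrow> rat fps" where "D = (\<lambda>f. fps_X * fps_deriv f)"
  define w where "w = (\<lambda>m. parity_sign m * of_int (2 * m + 1))"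
  define A where "A = theta_fps w triangle"
  define B where "B = theta_fps w (\<lambda>m. 4 * triangle m)"
  define W where "W = (A + fps_const 8 * D A) * B - A * (fps_const 4 * B + fps_const 8 * D B)"
  have nz: "a \<noteq> 0" "c \<noteq> 0"
    by (auto simp: a_b_c_def fps_eq_iff intro!: exI[of _ 0])
  have AB: "A = 2 * a ^ 3" "B = 2 * c ^ 3"
    using jacobi_cube_identity jacobi_cube_identity_power[of 4] by (simp_all add: A_def B_def w_def a_b_c_def)
  have "D (2 * f ^ 3) = 6 * f ^ 2 * D f" for f
    using fps_X_mult_deriv_mult[of 2 "f ^ 3"] fps_X_mult_deriv_power[of f 3]
    by (simp add: D_def)
  hence DAB: "D A = 6 * a ^ 2 * D a" "D B = 6 * c ^ 2 * D c"
    by (simp_all add: AB)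
  have "W = - 12 * a ^ 2 * c ^ 2 * (a * c + 8 * a * D c - 8 * c * D a)"
    unfolding W_def DAB unfolding AB numeral_fps_const[symmetric]
    by (simp add: algebra_simps power2_eq_square power3_eq_cube)
  also have "\<dots> = - 12 * (a * c) * (g ^ 6 * b ^ 2)"
  proof -
    have "g ^ 6 * b ^ 2 = a * c * (a * c + 8 * a * D c - 8 * c * D a)"
      unfolding g_def a_b_c_def D_def by (rule gauss_wronskian_identity)
    thus ?thesis by (simp add: power2_eq_square mult_ac)
  qed
  \<comment> \<open>Of the two factors \<open>g * a * c\<close>, one becomes \<open>b ^ 3\<close>;
    the other supplies the fifth \<open>g\<close> and the \<open>a * c\<close> that is cancelled at
    the end.\<close>
  finally have "(a * c) * W = - 12 * ((g * a * c) * (g * a * c) * g ^ 4 * b ^ 2)"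
    by (simp add: eval_nat_numeral mult_ac)
  also have "\<dots> = - 12 * ((g * a * c) * g ^ 4 * b ^ 5)"
  proof -
    have gac: "g * a * c = b ^ 3"
      unfolding g_def a_b_c_def by (rule euler_fps_minus_X)
    show ?thesis unfolding gac by (simp add: eval_nat_numeral mult_ac)
  qed
  also have "\<dots> = (a * c) * (- 12 * (g * b) ^ 5)"
    by (simp add: eval_nat_numeral mult_ac)
  finally have "W = - 12 * (g * b) ^ 5"
    using nz by (simp only: mult_left_cancel mult_eq_0_iff simp_thms)
  \<comment> \<open>\<open>b\<close> is a series in \<open>fps_X ^ 2\<close>.\<close>
  also have "b = b oo - fps_X"
    by (simp add: a_b_c_def fps_compose_assoc[symmetric] fps_X_power_compose)
  also have "- 12 * (g * (b oo - fps_X)) ^ 5 = - 12 * ((euler_fps * euler_power 2) ^ 5 oo - fps_X)"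
  proof -
    have "g * (b oo - fps_X) = euler_fps * euler_power 2 oo - fps_X"
      unfolding g_def a_b_c_def by (rule fps_compose_mult_distrib[symmetric]) simp
    moreover have "(euler_fps * euler_power 2 oo - fps_X) ^ 5 = (euler_fps * euler_power 2) ^ 5 oo - fps_X"
      by (rule fps_compose_power) simp
    ultimately show ?thesis by (simp only:)
  qed
  finally have "W = - 12 * ((euler_fps * euler_power 2) ^ 5 oo - fps_X)" .
  moreover have "W = theta_fps (\<lambda>(m, n). parity_sign m * parity_sign n * of_int ((2 * m + 1) * (2 * n + 1) *
       ((2 * m + 1) ^ 2 - 4 * (2 * n + 1) ^ 2))) (\<lambda>(m, n). triangle m + 4 * triangle n)"
  proof -
    have fin4: "finite {i. 4 * triangle i = n}" for n
      by (rule finite_subset[OF _ finite_triangle[of "n div 4"]]) auto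
    have sq: "8 * of_nat (triangle m) = (of_int ((2 * m + 1) ^ 2 - 1) :: rat)" for m
    proof -
      have "8 * int (triangle m) = (2 * m + 1) ^ 2 - 1"
        using int_triangle[of m] by (simp add: power2_eq_square algebra_simps)
      thus ?thesis by (metis of_int_mult of_int_numeral of_int_of_nat_eq)
    qed
    have "W = theta_fps (\<lambda>(m, n). (w m + 8 * (of_nat (triangle m) * w m)) * w n -
                w m * (4 * w n + 8 * (of_nat (4 * triangle n) * w n)))
                (\<lambda>(m, n). triangle m + 4 * triangle n)"
      unfolding W_def A_def B_def D_def theta_fps_deriv theta_fps_cmult theta_fps_add
      by (subst (1 2) theta_fps_mult) (simp_all add: finite_triangle fin4 theta_fps_diff split_def)
    also have "(\<lambda>(m, n). (w m + 8 * (of_nat (triangle m) * w m)) * w n -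
                w m * (4 * w n + 8 * (of_nat (4 * triangle n) * w n))) =
               (\<lambda>(m, n). w m * w n * (1 + 8 * of_nat (triangle m) - 4 - 4 * (8 * of_nat (triangle n))))"
      by (auto simp: fun_eq_iff algebra_simps)
    also have "\<dots> = (\<lambda>(m, n). parity_sign m * parity_sign n * of_int ((2 * m + 1) * (2 * n + 1) *
       ((2 * m + 1) ^ 2 - 4 * (2 * n + 1) ^ 2)))"
      unfolding sq w_def by (auto simp: fun_eq_iff algebra_simps)
    finally show ?thesis .
  qed
  ultimately show ?thesis by simp
qed

subsection \<open>Dissections\<close>

text \<open>For \<open>l\<close> dividing \<open>8 N + d\<close>, the coefficient of \<open>H\<close> at \<open>N\<close> is \<open>C\<close> times the coefficient at the
  \<open>N'\<close> with \<open>8 N + d = l\<^sup>2 (8 N' + d)\<close>, and vanishes if there is no such \<open>N'\<close>; here \<open>8 r + d = l\<^sup>2 d\<close>.\<close>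

definition dissects :: "nat \<Rightarrow> nat \<Rightarrow> nat \<Rightarrow> rat \<Rightarrow> rat fps \<Rightarrow> bool" where
  "dissects l d r C H \<longleftrightarrow>
     (\<forall>N. l dvd 8 * N + d \<longrightarrow> fps_nth H N = C * fps_nth (fps_X ^ r * (H oo fps_X ^ (l ^ 2))) N)"

text \<open>In the applications \<open>h\<close> multiplies each odd number \<open>2 * m + 1\<close>
  by \<open>l\<close>. Its range contains every index whose exponent lies in the progression, so the
  coefficient can be reindexed along \<open>h\<close>.\<close>

lemma theta_fps_dissects:
  assumes "inj h" "\<And>i. e (h i) = l ^ 2 * e i + r" "\<And>i. w (h i) = C * w i"
    and "\<And>i. l dvd 8 * e i + d \<Longrightarrow> i \<in> range h" "l > 0"
  shows "dissects l d r C (theta_fps w e)"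
  unfolding dissects_def
proof (intro allI impI)
  fix N assume N: "l dvd 8 * N + d"
  have "{i. e i = N} = h ` {i. l ^ 2 * e i + r = N}"
  proof (intro equalityI subsetI)
    fix i assume i: "i \<in> {i. e i = N}"
    hence "i \<in> range h" using assms(4)[of i] N by simp
    then obtain j where j: "i = h j" by blast
    hence "l ^ 2 * e j + r = N" using i assms(2)[of j] by simp
    thus "i \<in> h ` {i. l ^ 2 * e i + r = N}" unfolding j by blast
  next
    fix i assume "i \<in> h ` {i. l ^ 2 * e i + r = N}"
    thus "i \<in> {i. e i = N}" using assms(2) by auto
  qed
  moreover have "inj_on h {i. l ^ 2 * e i + r = N}"
    using assms(1) by (rule inj_on_subset) simp
  ultimately have "fps_nth (theta_fps w e) N = (\<Sum>i | l ^ 2 * e i + r = N. w (h i))"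
    by (simp add: theta_fps_nth sum.reindex)
  also have "\<dots> = C * (\<Sum>i | l ^ 2 * e i + r = N. w i)"
    by (simp add: assms(3) sum_distrib_left)
  also have "(\<Sum>i | l ^ 2 * e i + r = N. w i) = fps_nth (fps_X ^ r * (theta_fps w e oo fps_X ^ (l ^ 2))) N"
  proof (cases "r \<le> N")
    case True
    hence "{i. l ^ 2 * e i + r = N} = {i. l ^ 2 * e i = N - r}" by auto
    thus ?thesis using True assms(5)
      by (simp add: theta_fps_compose_X_power fps_X_power_mult_nth theta_fps_nth)
  qed (auto simp: fps_X_power_mult_nth intro!: sum.neutral)
  finally show "fps_nth (theta_fps w e) N = C * fps_nth (fps_X ^ r * (theta_fps w e oo fps_X ^ (l ^ 2))) N" .
qed

lemma dissects_cmult: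
  assumes "dissects l d r C (fps_const c * H)" "c \<noteq> 0" "l > 0"
  shows   "dissects l d r C H"
  unfolding dissects_def
proof (intro allI impI)
  fix N assume N: "l dvd 8 * N + d"
  let ?K = "fps_X ^ r * (H oo fps_X ^ (l ^ 2))"
  have "fps_const c * H oo fps_X ^ (l ^ 2) = fps_const c * (H oo fps_X ^ (l ^ 2))"
    using assms(3) by (subst fps_compose_mult_distrib) auto
  hence "fps_X ^ r * (fps_const c * H oo fps_X ^ (l ^ 2)) = fps_const c * ?K"
    by (simp only: mult.left_commute)
  hence "c * fps_nth H N = C * (c * fps_nth ?K N)"
    using assms(1) N by (simp only: dissects_def fps_mult_left_const_nth)
  hence "c * fps_nth H N = c * (C * fps_nth ?K N)"
    by (simp only: mult.left_commute)
  thus "fps_nth H N = C * fps_nth ?K N"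
    using assms(2) by simp
qed

text \<open>For \<open>N = r + l ^ 2 * n\<close> with \<open>r\<close> and \<open>l\<close> odd,
  \<open>N\<close> and \<open>n\<close> have opposite parity, whence the change of sign of
  \<open>C\<close>.\<close>

lemma dissects_compose_minus_X:
  assumes "dissects l d r C (H oo - fps_X)" "odd l" "odd r"
  shows   "dissects l d r (- C) H"
  unfolding dissects_def
proof (intro allI impI)
  fix N assume "l dvd 8 * N + d"
  hence *: "(-1) ^ N * fps_nth H N = C * fps_nth (fps_X ^ r * ((H oo - fps_X) oo fps_X ^ (l ^ 2))) N"
    using assms(1) by (simp add: dissects_def fps_compose_uminus')
  show "fps_nth H N = - C * fps_nth (fps_X ^ r * (H oo fps_X ^ (l ^ 2))) N"
  proof (cases "r \<le> N \<and> l ^ 2 dvd N - r")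
    case True
    then obtain n where "N - r = l ^ 2 * n" by blast
    hence N: "N = r + l ^ 2 * n" using True by simp
    have "(-1 :: rat) ^ N = - ((-1) ^ n)"
      using assms(2,3) by (simp add: N power_add minus_one_power_iff)
    thus ?thesis using * assms(2)
      by (simp add: N fps_X_power_mult_nth fps_nth_compose_X_power fps_compose_uminus' odd_pos)
         (cases "even n"; simp)
  qed (use * in \<open>auto simp: fps_X_power_mult_nth fps_nth_compose_X_power split: if_splits\<close>)
qed

lemma eight_triangle: "8 * int (triangle m) = (2 * m + 1) ^ 2 - 1"
  using int_triangle[of m] by (simp add: power2_eq_square algebra_simps)

lemma triangle_affine:
  "triangle (5 * m + 2) = 25 * triangle m + 3" "triangle (3 * m + 1) = 9 * triangle m + 1"
proof -
  have "2 * int (25 * triangle m + 3) = 25 * (2 * int (triangle m)) + 6"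
       "2 * int (9 * triangle m + 1) = 9 * (2 * int (triangle m)) + 2"
    by simp_all
  hence "2 * int (triangle (5 * m + 2)) = 2 * int (25 * triangle m + 3)"
        "2 * int (triangle (3 * m + 1)) = 2 * int (9 * triangle m + 1)"
    unfolding int_triangle by (simp_all add: algebra_simps)
  thus "triangle (5 * m + 2) = 25 * triangle m + 3" "triangle (3 * m + 1) = 9 * triangle m + 1"
    by simp_all
qed

text \<open>Neither -2 nor -3 is a square modulo 5.\<close>

lemma mod_5_anisotropic:
  fixes x y D :: int
  assumes "5 dvd x ^ 2 + D * y ^ 2" "D = 2 \<or> D = 3"
  shows   "5 dvd x \<and> 5 dvd y"
proof -
  define i j where "i = x mod 5" and "j = y mod 5"
  have "(x ^ 2 + D * y ^ 2) mod 5 = (i ^ 2 + D * j ^ 2) mod 5"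
    unfolding i_def j_def by (intro mod_add_cong mod_mult_cong refl) (simp_all add: power_mod)
  hence "(i ^ 2 + D * j ^ 2) mod 5 = 0"
    using assms(1) by (simp add: dvd_eq_mod_eq_0)
  moreover have "i \<in> {0, 1, 2, 3, 4}" "j \<in> {0, 1, 2, 3, 4}"
    by (auto simp: i_def j_def)
  ultimately have "i = 0 \<and> j = 0" using assms(2) by auto
  thus ?thesis by (simp add: i_def j_def dvd_eq_mod_eq_0)
qed

text \<open>The form reduces to a sum of two squares, and -1 is not a square modulo 3.\<close>

lemma mod_3_anisotropic:
  fixes x y :: int
  assumes "3 dvd x ^ 2 + 4 * y ^ 2"
  shows   "3 dvd x \<and> 3 dvd y"
proof -
  define i j where "i = x mod 3" and "j = y mod 3"
  have "(x ^ 2 + 4 * y ^ 2) mod 3 = (i ^ 2 + 4 * j ^ 2) mod 3"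
    unfolding i_def j_def by (intro mod_add_cong mod_mult_cong refl) (simp_all add: power_mod)
  hence "(i ^ 2 + 4 * j ^ 2) mod 3 = 0"
    using assms(1) by (simp add: dvd_eq_mod_eq_0)
  moreover have "i \<in> {0, 1, 2}" "j \<in> {0, 1, 2}"
    by (auto simp: i_def j_def)
  ultimately have "i = 0 \<and> j = 0" by auto
  thus ?thesis by (simp add: i_def j_def dvd_eq_mod_eq_0)
qed

text \<open>With \<open>x = 2 * m + 1\<close> and \<open>y = 2 * n + 1\<close>, 8 times the exponent
  plus \<open>1 + D\<close> is \<open>x ^ 2 + D * y ^ 2\<close>, and the weight is
  \<open>x * y\<close> up to sign. Scaling both variables by 5 multiplies the weight by 25;
  \<open>r\<close> comes from \<open>triangle_affine\<close>.\<close>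

lemma euler_cube_dissects:
  assumes "D = 2 \<or> D = 3" "d = 1 + D" "r = 3 + 3 * D"
  shows   "dissects 5 d r 25 ((euler_fps * euler_power D) ^ 3)"
  unfolding assms(2,3)
proof (rule dissects_cmult)
  let ?w = "\<lambda>m. parity_sign m * of_int (2 * m + 1)"
  let ?h = "\<lambda>(m, n). (5 * m + 2 :: int, 5 * n + 2 :: int)"
  have D: "D > 0" using assms(1) by auto
  have finD: "finite {i. D * triangle i = n}" for n
    by (rule finite_subset[OF _ finite_triangle[of "n div D"]]) (use D in auto)
  have "fps_const 4 * (euler_fps * euler_power D) ^ 3 = (2 * euler_fps ^ 3) * (2 * euler_power D ^ 3)"
    by (simp add: power_mult_distrib numeral_fps_const[symmetric])
  also have "\<dots> = theta_fps (\<lambda>(m, n). ?w m * ?w n) (\<lambda>(m, n). triangle m + D * triangle n)"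
    unfolding jacobi_cube_identity[symmetric] jacobi_cube_identity_power[OF D, symmetric]
    by (rule theta_fps_mult) (rule finite_triangle finD)+
  also have "dissects 5 (1 + D) (3 + 3 * D) 25 \<dots>"
  proof (rule theta_fps_dissects)
    show "inj ?h" by (auto simp: inj_on_def)
    show "(case ?h i of (m, n) \<Rightarrow> triangle m + D * triangle n) =
          5 ^ 2 * (case i of (m, n) \<Rightarrow> triangle m + D * triangle n) + (3 + 3 * D)" for i
      by (cases i) (simp add: triangle_affine, simp add: algebra_simps)
    show "(case ?h i of (m, n) \<Rightarrow> ?w m * ?w n) = 25 * (case i of (m, n) \<Rightarrow> ?w m * ?w n)" for i
      by (cases i) (simp add: parity_sign_def algebra_simps)
    show "i \<in> range ?h" if "5 dvd 8 * (case i of (m, n) \<Rightarrow> triangle m + D * triangle n) + (1 + D)" for i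
    proof -
      obtain m n where i: "i = (m, n)" by (cases i)
      have "int (8 * (triangle m + D * triangle n) + (1 + D)) =
              8 * int (triangle m) + int D * (8 * int (triangle n)) + 1 + int D"
        by (simp add: algebra_simps)
      also have "\<dots> = (2 * m + 1) ^ 2 + int D * (2 * n + 1) ^ 2"
        unfolding eight_triangle by (simp add: algebra_simps)
      finally have eq: "int (8 * (triangle m + D * triangle n) + (1 + D)) = \<dots>" .
      have "5 dvd 8 * (triangle m + D * triangle n) + (1 + D)"
        using that by (simp only: i prod.case)
      hence "int 5 dvd int (8 * (triangle m + D * triangle n) + (1 + D))"
        by (simp only: int_dvd_int_iff)
      hence "5 dvd (2 * m + 1) ^ 2 + int D * (2 * n + 1) ^ 2"
        unfolding eq by simp
      hence "5 dvd 2 * m + 1 \<and> 5 dvd 2 * n + 1"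
        by (rule mod_5_anisotropic) (use assms(1) in auto)
      hence "m = 5 * (m div 5) + 2" "n = 5 * (n div 5) + 2" by presburger+
      thus ?thesis unfolding i by (intro image_eqI[of _ _ "(m div 5, n div 5)"]) auto
    qed
  qed simp
  finally show "dissects 5 (1 + D) (3 + 3 * D) 25 (fps_const 4 * (euler_fps * euler_power D) ^ 3)" .
qed simp_all

text \<open>The weight has degree 4 in the odd variables, so scaling them by 3 gives 81, and the two
  sign changes cancel. Undoing the substitution of \<open>- fps_X\<close> turns 81 into -81.\<close>

lemma euler_fifth_power_dissects: "dissects 3 5 5 (- 81) ((euler_fps * euler_power 2) ^ 5)"
proof (rule dissects_compose_minus_X[OF dissects_cmult])
  let ?w = "\<lambda>(m, n). parity_sign m * parity_sign n * of_int ((2 * m + 1) * (2 * n + 1) *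
       ((2 * m + 1) ^ 2 - 4 * (2 * n + 1) ^ 2)) :: rat"
  let ?h = "\<lambda>(m, n). (3 * m + 1 :: int, 3 * n + 1 :: int)"
  have "fps_const (- 12) * ((euler_fps * euler_power 2) ^ 5 oo - fps_X) =
        theta_fps ?w (\<lambda>(m, n). triangle m + 4 * triangle n)"
    unfolding euler_fifth_power_theta by (simp add: numeral_fps_const flip: fps_const_neg)
  also have "dissects 3 5 5 81 \<dots>"
  proof (rule theta_fps_dissects)
    show "inj ?h" by (auto simp: inj_on_def)
    show "(case ?h i of (m, n) \<Rightarrow> triangle m + 4 * triangle n) =
          3 ^ 2 * (case i of (m, n) \<Rightarrow> triangle m + 4 * triangle n) + 5" for i
      by (cases i) (simp add: triangle_affine)
    show "?w (?h i) = 81 * ?w i" for i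
    proof (cases i)
      case (Pair m n)
      have "(2 * (3 * m + 1) + 1) * (2 * (3 * n + 1) + 1) *
              ((2 * (3 * m + 1) + 1) ^ 2 - 4 * (2 * (3 * n + 1) + 1) ^ 2) =
            81 * ((2 * m + 1) * (2 * n + 1) * ((2 * m + 1) ^ 2 - 4 * (2 * n + 1) ^ 2))"
        by (simp add: power2_eq_square algebra_simps)
      moreover have "parity_sign (3 * m + 1) * parity_sign (3 * n + 1) = parity_sign m * parity_sign n"
        by (simp add: parity_sign_def)
      ultimately show ?thesis unfolding Pair prod.case by simp
    qed
    show "i \<in> range ?h" if "3 dvd 8 * (case i of (m, n) \<Rightarrow> triangle m + 4 * triangle n) + 5" for i
    proof -
      obtain m n where i: "i = (m, n)" by (cases i)
      have "int (8 * (triangle m + 4 * triangle n) + 5) =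
              8 * int (triangle m) + 4 * (8 * int (triangle n)) + 5"
        by (simp add: algebra_simps)
      also have "\<dots> = (2 * m + 1) ^ 2 + 4 * (2 * n + 1) ^ 2"
        unfolding eight_triangle by (simp add: algebra_simps)
      finally have eq: "int (8 * (triangle m + 4 * triangle n) + 5) = \<dots>" .
      have "3 dvd 8 * (triangle m + 4 * triangle n) + 5"
        using that by (simp only: i prod.case)
      hence "int 3 dvd int (8 * (triangle m + 4 * triangle n) + 5)"
        by (simp only: int_dvd_int_iff)
      hence "3 dvd (2 * m + 1) ^ 2 + 4 * (2 * n + 1) ^ 2"
        unfolding eq by simp
      hence "3 dvd 2 * m + 1 \<and> 3 dvd 2 * n + 1"
        by (rule mod_3_anisotropic)
      hence "m = 3 * (m div 3) + 1" "n = 3 * (n div 3) + 1" by presburger+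
      thus ?thesis unfolding i by (intro image_eqI[of _ _ "(m div 3, n div 3)"]) auto
    qed
  qed simp
  finally show "dissects 3 5 5 81 (fps_const (- 12) * ((euler_fps * euler_power 2) ^ 5 oo - fps_X))" .
qed simp_all

subsection \<open>Congruences modulo powers of a prime\<close>

text \<open>For prime \<open>p\<close>, the ideal generated by \<open>p ^ k\<close> in the
  localization of the integers at \<open>p\<close>.\<close>

definition rat_ideal :: "nat \<Rightarrow> nat \<Rightarrow> rat set" where
  "rat_ideal p k = {x. \<exists>a b. coprime b (int p) \<and> b \<noteq> 0 \<and> x = of_nat p ^ k * of_int a / of_int b}"

lemma rat_idealI:
  "coprime b (int p) \<Longrightarrow> b \<noteq> 0 \<Longrightarrow> x = of_nat p ^ k * of_int a / of_int b \<Longrightarrow> x \<in> rat_ideal p k"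
  unfolding rat_ideal_def by blast

lemma rat_idealE:
  assumes "x \<in> rat_ideal p k"
  obtains a b where "coprime b (int p)" "b \<noteq> 0" "x = of_nat p ^ k * of_int a / of_int b"
  using assms unfolding rat_ideal_def by blast

lemma rat_ideal_of_int: "of_nat p ^ k * of_int a \<in> rat_ideal p k"
  by (rule rat_idealI[of 1 _ _ _ a]) auto

lemma rat_ideal_0 [simp]: "0 \<in> rat_ideal p k"
  using rat_ideal_of_int[of p k 0] by simp

lemma rat_ideal_1 [simp]: "1 \<in> rat_ideal p 0"
  using rat_ideal_of_int[of p 0 1] by simp

lemma rat_ideal_add:
  assumes "x \<in> rat_ideal p k" "y \<in> rat_ideal p k"
  shows   "x + y \<in> rat_ideal p k"
proof -
  from assms(1) obtain a b where 1: "coprime b (int p)" "b \<noteq> 0" "x = of_nat p ^ k * of_int a / of_int b"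
    by (elim rat_idealE)
  from assms(2) obtain c d where 2: "coprime d (int p)" "d \<noteq> 0" "y = of_nat p ^ k * of_int c / of_int d"
    by (elim rat_idealE)
  show ?thesis
    by (rule rat_idealI[of "b * d" _ _ _ "a * d + c * b"]) (use 1 2 in \<open>auto simp: field_simps\<close>)
qed

lemma rat_ideal_mult:
  assumes "x \<in> rat_ideal p j" "y \<in> rat_ideal p k"
  shows   "x * y \<in> rat_ideal p (j + k)"
proof -
  from assms(1) obtain a b where 1: "coprime b (int p)" "b \<noteq> 0" "x = of_nat p ^ j * of_int a / of_int b"
    by (elim rat_idealE)
  from assms(2) obtain c d where 2: "coprime d (int p)" "d \<noteq> 0" "y = of_nat p ^ k * of_int c / of_int d"
    by (elim rat_idealE)
  show ?thesis
    by (rule rat_idealI[of "b * d" _ _ _ "a * c"]) (use 1 2 in \<open>auto simp: power_add\<close>)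
qed

lemma rat_ideal_mono:
  assumes "x \<in> rat_ideal p k" "j \<le> k"
  shows   "x \<in> rat_ideal p j"
proof -
  from assms(1) obtain a b where 1: "coprime b (int p)" "b \<noteq> 0" "x = of_nat p ^ k * of_int a / of_int b"
    by (elim rat_idealE)
  have "(of_nat p ^ k :: rat) = of_nat p ^ j * of_nat p ^ (k - j)"
    using assms(2) by (simp flip: power_add)
  thus ?thesis
    by (intro rat_idealI[of b _ _ _ "int p ^ (k - j) * a"]) (use 1 in auto)
qed

lemma rat_ideal_uminus: "x \<in> rat_ideal p k \<Longrightarrow> - x \<in> rat_ideal p k"
  using rat_ideal_mult[of x p k "-1" 0] rat_ideal_of_int[of p 0 "-1"] by simp

lemma rat_ideal_diff: "x \<in> rat_ideal p k \<Longrightarrow> y \<in> rat_ideal p k \<Longrightarrow> x - y \<in> rat_ideal p k"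
  using rat_ideal_add[of x p k "-y"] rat_ideal_uminus[of y p k] by simp

lemma rat_ideal_sum: "(\<And>i. i \<in> A \<Longrightarrow> f i \<in> rat_ideal p k) \<Longrightarrow> sum f A \<in> rat_ideal p k"
  by (induction A rule: infinite_finite_induct) (auto intro: rat_ideal_add)

lemma rat_ideal_cancel:
  assumes "of_nat n * x \<in> rat_ideal p k" "coprime n p" "n > 0"
  shows   "x \<in> rat_ideal p k"
proof -
  from assms(1) obtain a b where 1: "coprime b (int p)" "b \<noteq> 0" "of_nat n * x = of_nat p ^ k * of_int a / of_int b"
    by (elim rat_idealE)
  have "x = of_nat n * x / of_nat n" using assms(3) by simp
  also have "\<dots> = of_nat p ^ k * of_int a / of_int (b * int n)"
    unfolding 1(3) by simp
  finally show ?thesis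
    using 1(1,2) assms(2,3) by (intro rat_idealI[of "b * int n" _ _ _ a]) auto
qed

text \<open>Fermat's little theorem for numerator and denominator: for \<open>x = a / b\<close> the
  difference is \<open>b * (a ^ p - a) - a * (b ^ p - b)\<close> divided by
  \<open>b ^ p * b\<close>.\<close>

lemma rat_ideal_frobenius:
  assumes "prime p" "x \<in> rat_ideal p 0"
  shows   "x ^ p - x \<in> rat_ideal p 1"
proof -
  from assms(2) obtain a b where 1: "coprime b (int p)" "b \<noteq> 0" "x = of_int a / of_int b"
    by (elim rat_idealE) auto
  have fermat: "int p dvd c ^ p - c" for c
  proof -
    define c' where "c' = nat (c mod int p)"
    have p: "p > 0" using assms(1) prime_gt_0_nat by blast
    have c': "[c = int c'] (mod int p)"
      using p by (simp add: c'_def cong_def)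
    have "[c' ^ p = c'] (mod p)"
    proof (cases "p dvd c'")
      case True
      hence "p dvd c' ^ p" by (rule dvd_trans) (use p in \<open>simp add: dvd_power\<close>)
      thus ?thesis using True by (simp add: cong_def mod_eq_0_iff_dvd)
    next
      case False
      have "[c' ^ (p - 1) * c' = 1 * c'] (mod p)"
        using fermat_theorem[OF assms(1) False] by (rule cong_scalar_right)
      thus ?thesis using p by (simp flip: power_Suc2)
    qed
    hence "[int c' ^ p = int c'] (mod int p)"
      by (simp flip: of_nat_power add: cong_int_iff)
    moreover have "[c ^ p = int c' ^ p] (mod int p)"
      using c' by (rule cong_pow)
    ultimately have "[c ^ p = c] (mod int p)"
      using cong_trans[OF cong_trans cong_sym[OF c']] by blast
    thus ?thesis by (simp add: cong_iff_dvd_diff)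
  qed
  have "int p dvd b * (a ^ p - a) - a * (b ^ p - b)"
    by (rule dvd_diff[OF dvd_mult[OF fermat] dvd_mult[OF fermat]])
  then obtain c where c: "b * (a ^ p - a) - a * (b ^ p - b) = int p * c" ..
  have "x ^ p - x = of_int (b * (a ^ p - a) - a * (b ^ p - b)) / of_int (b ^ p * b)"
    unfolding 1(3) using 1(2) by (simp add: field_simps)
  also have "\<dots> = of_nat p ^ 1 * of_int c / of_int (b ^ p * b)"
    unfolding c by simp
  finally show ?thesis
    using 1 by (intro rat_idealI[of "b ^ p * b" _ _ _ c]) auto
qed

section \<open>Frobenius congruences and integrality of power series\<close>

definition fps_ideal :: "nat \<Rightarrow> nat \<Rightarrow> rat fps set" where
  "fps_ideal p k = {F. \<forall>n. fps_nth F n \<in> rat_ideal p k}"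

lemma fps_idealD: "F \<in> fps_ideal p k \<Longrightarrow> fps_nth F n \<in> rat_ideal p k"
  by (simp add: fps_ideal_def)

lemma fps_ideal_0 [simp]: "0 \<in> fps_ideal p k"
  by (simp add: fps_ideal_def)

lemma fps_ideal_add: "F \<in> fps_ideal p k \<Longrightarrow> G \<in> fps_ideal p k \<Longrightarrow> F + G \<in> fps_ideal p k"
  by (simp add: fps_ideal_def rat_ideal_add)

lemma fps_ideal_diff: "F \<in> fps_ideal p k \<Longrightarrow> G \<in> fps_ideal p k \<Longrightarrow> F - G \<in> fps_ideal p k"
  by (simp add: fps_ideal_def rat_ideal_diff)

lemma fps_ideal_mult: "F \<in> fps_ideal p j \<Longrightarrow> G \<in> fps_ideal p k \<Longrightarrow> F * G \<in> fps_ideal p (j + k)"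
  by (auto simp: fps_ideal_def fps_mult_nth intro!: rat_ideal_sum rat_ideal_mult)

lemma fps_ideal_mono: "F \<in> fps_ideal p k \<Longrightarrow> j \<le> k \<Longrightarrow> F \<in> fps_ideal p j"
  by (auto simp: fps_ideal_def intro: rat_ideal_mono)

lemma fps_ideal_const: "c \<in> rat_ideal p k \<Longrightarrow> fps_const c \<in> fps_ideal p k"
  by (simp add: fps_ideal_def)

lemma fps_ideal_1 [simp]: "1 \<in> fps_ideal p 0"
  by (simp add: fps_ideal_def)

lemma fps_ideal_X_power [simp]: "fps_X ^ n \<in> fps_ideal p 0"
  by (simp add: fps_ideal_def)

lemma fps_ideal_power: "F \<in> fps_ideal p k \<Longrightarrow> F ^ n \<in> fps_ideal p (k * n)"
  by (induction n) (auto dest: fps_ideal_mult)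

lemma fps_ideal_sum: "(\<And>i. i \<in> A \<Longrightarrow> f i \<in> fps_ideal p k) \<Longrightarrow> sum f A \<in> fps_ideal p k"
  by (induction A rule: infinite_finite_induct) (auto intro: fps_ideal_add)

lemma fps_ideal_compose_X_power: "F \<in> fps_ideal p k \<Longrightarrow> F oo fps_X ^ d \<in> fps_ideal p k"
  by (simp add: fps_ideal_def fps_nth_compose_X_power)

text \<open>Each mixed binomial term carries a factor \<open>p\<close> from the binomial coefficient
  and at least one factor \<open>G\<close>.\<close>

lemma fps_ideal_prime_power_add:
  assumes "prime p" "F \<in> fps_ideal p 0" "G \<in> fps_ideal p k"
  shows   "(F + G) ^ p - F ^ p - G ^ p \<in> fps_ideal p (Suc k)"
proof -
  obtain q where q: "p = Suc (Suc q)"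
    using prime_ge_2_nat[OF assms(1)] by (auto simp: numeral_2_eq_2 Suc_le_eq gr0_conv_Suc less_iff_Suc_add)
  define t where "t = (\<lambda>m. of_nat (p choose m) * G ^ m * F ^ (p - m))"
  have "(F + G) ^ p = (\<Sum>m\<le>p. t m)"
    unfolding t_def by (subst add.commute) (rule binomial_ring)
  also have "\<dots> = F ^ p + (\<Sum>m=1..<p. t m) + G ^ p"
  proof -
    have "{..p} = insert 0 (insert p {1..<p})" using q by auto
    thus ?thesis using q by (simp add: t_def)
  qed
  finally have "(F + G) ^ p - F ^ p - G ^ p = (\<Sum>m=1..<p. t m)" by simp
  also have "\<dots> \<in> fps_ideal p (Suc k)"
  proof (rule fps_ideal_sum)
    fix m assume m: "m \<in> {1..<p}"
    hence "p dvd (p choose m)" using assms(1) by (intro dvd_choose_prime) auto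
    then obtain c where "p choose m = p * c" ..
    hence "of_nat (p choose m) \<in> rat_ideal p 1"
      using rat_ideal_of_int[of p 1 "int c"] by simp
    hence "of_nat (p choose m) \<in> fps_ideal p 1"
      unfolding fps_of_nat[symmetric] by (rule fps_ideal_const)
    moreover have "G ^ m \<in> fps_ideal p k"
      using fps_ideal_power[OF assms(3), of m] by (rule fps_ideal_mono) (use m in auto)
    moreover have "F ^ (p - m) \<in> fps_ideal p 0"
      using fps_ideal_power[OF assms(2), of "p - m"] by simp
    ultimately have "of_nat (p choose m) * G ^ m * F ^ (p - m) \<in> fps_ideal p (1 + k + 0)"
      by (intro fps_ideal_mult)
    thus "t m \<in> fps_ideal p (Suc k)" by (simp add: t_def)
  qed
  finally show ?thesis .
qed

text \<open>The \<open>p\<close>-th power is additive modulo \<open>p\<close>, and on monomials the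
  claim is Fermat's theorem for the coefficient. This settles the partial sums, and each coefficient
  of the limit is already attained by one of them.\<close>

lemma fps_ideal_frobenius:
  assumes "prime p" "F \<in> fps_ideal p 0"
  shows   "F ^ p - (F oo fps_X ^ p) \<in> fps_ideal p 1"
proof -
  have p: "p > 0" using assms(1) prime_gt_0_nat by blast
  define T where "T = (\<lambda>n. \<Sum>i\<le>n. fps_const (fps_nth F i) * fps_X ^ i)"
  have T0: "T n \<in> fps_ideal p 0" for n
    unfolding T_def using fps_ideal_mult[OF fps_ideal_const[OF fps_idealD[OF assms(2)]] fps_ideal_X_power]
    by (intro fps_ideal_sum) simp
  have monom: "(fps_const c * fps_X ^ i) ^ p - (fps_const c * fps_X ^ i oo fps_X ^ p) \<in> fps_ideal p 1"
    if "c \<in> rat_ideal p 0" for c i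
  proof -
    have "fps_const (c ^ p - c) * fps_X ^ (i * p) \<in> fps_ideal p (1 + 0)"
      by (intro fps_ideal_mult fps_ideal_const rat_ideal_frobenius assms that fps_ideal_X_power)
    moreover have "(fps_const c * fps_X ^ i) ^ p - (fps_const c * fps_X ^ i oo fps_X ^ p) =
                     fps_const (c ^ p - c) * fps_X ^ (i * p)"
      using p by (simp add: power_mult_distrib fps_compose_mult_distrib fps_X_power_compose
                    fps_const_power power_mult[symmetric] mult.commute[of i] left_diff_distrib
                    flip: fps_const_sub)
    ultimately show ?thesis by simp
  qed
  have "T n ^ p - (T n oo fps_X ^ p) \<in> fps_ideal p 1" for n
  proof (induction n)
    case 0
    show ?case using monom[OF fps_idealD[OF assms(2)], of 0 0] by (simp add: T_def)
  next
    case (Suc n)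
    define M where "M = fps_const (fps_nth F (Suc n)) * fps_X ^ Suc n"
    have M0: "M \<in> fps_ideal p 0"
      unfolding M_def using fps_ideal_mult[OF fps_ideal_const[OF fps_idealD[OF assms(2)]] fps_ideal_X_power]
      by (simp del: power_Suc)
    have TS: "T (Suc n) = T n + M" by (simp add: T_def M_def)
    have "(T n + M) ^ p - T n ^ p - M ^ p \<in> fps_ideal p 1"
      using fps_ideal_prime_power_add[OF assms(1) T0 M0] by simp
    moreover have "M ^ p - (M oo fps_X ^ p) \<in> fps_ideal p 1"
      unfolding M_def by (rule monom[OF fps_idealD[OF assms(2)]])
    ultimately have "((T n + M) ^ p - T n ^ p - M ^ p) + (T n ^ p - (T n oo fps_X ^ p)) + (M ^ p - (M oo fps_X ^ p))
            \<in> fps_ideal p 1"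
      by (intro fps_ideal_add Suc.IH)
    thus ?case by (simp add: TS fps_compose_add_distrib algebra_simps)
  qed
  note T = this
  have lim: "T \<longlonglongrightarrow> F"
    using fps_notation[of F] by (simp add: T_def[abs_def] atLeast0AtMost)
  show ?thesis unfolding fps_ideal_def
  proof safe
    fix n
    have "eventually (\<lambda>m. fps_nth (T m ^ p) n = fps_nth (F ^ p) n) sequentially"
         "eventually (\<lambda>m. fps_nth (T m oo fps_X ^ p) n = fps_nth (F oo fps_X ^ p) n) sequentially"
      using tendsto_fps_power[OF lim] tendsto_fps_compose[OF lim] by (simp_all add: tendsto_fps_iff)
    hence "eventually (\<lambda>m. fps_nth (T m ^ p - (T m oo fps_X ^ p)) n = fps_nth (F ^ p - (F oo fps_X ^ p)) n) sequentially"
      by eventually_elim simp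
    then obtain m where "fps_nth (T m ^ p - (T m oo fps_X ^ p)) n = fps_nth (F ^ p - (F oo fps_X ^ p)) n"
      using eventually_happens by force
    thus "fps_nth (F ^ p - (F oo fps_X ^ p)) n \<in> rat_ideal p 1"
      using fps_idealD[OF T[of m], of n] by simp
  qed
qed

text \<open>Taking \<open>p\<close>-th powers raises the modulus by a factor \<open>p\<close>: in
  the expansion of \<open>B + (A - B)\<close> the mixed terms gain a factor \<open>p\<close>, and
  \<open>(A - B) ^ p\<close> is divisible enough because \<open>p\<close> is at least 2.\<close>

lemma fps_ideal_frobenius_power:
  assumes "prime p" "F \<in> fps_ideal p 0"
  shows   "F ^ (p ^ Suc k) - (F oo fps_X ^ p) ^ (p ^ k) \<in> fps_ideal p (Suc k)"
proof (induction k)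
  case 0
  show ?case using fps_ideal_frobenius[OF assms] by simp
next
  case (Suc k)
  define A B where "A = F ^ (p ^ Suc k)" and "B = (F oo fps_X ^ p) ^ (p ^ k)"
  have B: "B \<in> fps_ideal p 0"
    using fps_ideal_power[OF fps_ideal_compose_X_power[OF assms(2)]] by (simp add: B_def)
  have D: "A - B \<in> fps_ideal p (Suc k)"
    using Suc.IH by (simp add: A_def B_def)
  have "(A - B) ^ p \<in> fps_ideal p (Suc k * p)"
    using D by (rule fps_ideal_power)
  hence "(A - B) ^ p \<in> fps_ideal p (Suc (Suc k))"
  proof (rule fps_ideal_mono)
    have "Suc k * 2 \<le> Suc k * p"
      using prime_ge_2_nat[OF assms(1)] by (rule mult_left_mono) simp
    thus "Suc (Suc k) \<le> Suc k * p" by simp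
  qed
  hence "((B + (A - B)) ^ p - B ^ p - (A - B) ^ p) + (A - B) ^ p \<in> fps_ideal p (Suc (Suc k))"
    by (intro fps_ideal_add fps_ideal_prime_power_add assms B D)
  thus ?case
    by (simp add: A_def B_def mult.commute[of p] flip: power_mult)
qed

text \<open>The coefficient of \<open>G ^ b\<close> at \<open>n\<close> is \<open>b\<close> times
  that of \<open>G\<close> plus a contribution of the earlier coefficients, and \<open>b\<close> can
  be divided out.\<close>

lemma fps_ideal_root:
  assumes "fps_nth G 0 = 1" "G ^ b \<in> fps_ideal p 0" "b > 0" "coprime b p"
  shows   "G \<in> fps_ideal p 0"
proof -
  have "fps_nth G n \<in> rat_ideal p 0" for n
  proof (induction n rule: less_induct)
    case (less n)
    show ?case
    proof (cases "n = 0")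
      case False
      define T where "T = fps_cutoff n G"
      have T: "T \<in> fps_ideal p 0"
        using less.IH by (simp add: T_def fps_ideal_def)
      have T0: "fps_nth T 0 = 1"
        using False assms(1) by (simp add: T_def)
      define R where "R = fps_shift n G"
      have GT: "G - T = fps_X ^ n * R"
        by (rule fps_ext) (simp add: T_def R_def fps_X_power_mult_nth)
      obtain b' where b': "b = Suc b'" using assms(3) by (cases b) auto
      \<comment> \<open>\<open>G - T\<close> starts at degree \<open>n\<close>, and the sum on the
        right has constant term \<open>b\<close>.\<close>
      have "G ^ b - T ^ b = fps_X ^ n * (R * (\<Sum>j<b. G ^ j * T ^ (b' - j)))"
        unfolding b' diff_power_eq_sum GT by (simp only: mult.assoc)
      hence "fps_nth (G ^ b - T ^ b) n = fps_nth (fps_X ^ n * (R * (\<Sum>j<b. G ^ j * T ^ (b' - j)))) n"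
        by (rule arg_cong)
      also have "\<dots> = of_nat b * fps_nth G n"
        using assms(1) T0 by (simp add: fps_X_power_mult_nth R_def fps_sum_nth fps_power_zeroth b')
      finally have "of_nat b * fps_nth G n = fps_nth (G ^ b) n - fps_nth (T ^ b) n"
        by simp
      also have "\<dots> \<in> rat_ideal p 0"
        using fps_ideal_power[OF T, of b] by (intro rat_ideal_diff fps_idealD assms) simp
      finally show ?thesis
        by (rule rat_ideal_cancel) (rule assms)+
    qed (simp add: assms(1))
  qed
  thus ?thesis by (simp add: fps_ideal_def)
qed

lemma fps_ideal_cofactor_of_1:
  assumes "F * G = 1" "fps_nth G 0 = 1" "G \<in> fps_ideal p 0"
  shows   "F \<in> fps_ideal p 0"
proof -
  have "fps_nth F n \<in> rat_ideal p 0" for n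
  proof (induction n rule: less_induct)
    case (less n)
    have "(\<Sum>i\<le>n. fps_nth F i * fps_nth G (n - i)) = fps_nth (1 :: rat fps) n"
      unfolding assms(1)[symmetric] by (simp add: fps_mult_nth atLeast0AtMost)
    moreover have "{..n} = insert n {..<n}" by auto
    ultimately have "fps_nth F n = fps_nth (1 :: rat fps) n - (\<Sum>i<n. fps_nth F i * fps_nth G (n - i))"
      using assms(2) by simp
    also have "\<dots> \<in> rat_ideal p (0 + 0)"
      by (intro rat_ideal_diff rat_ideal_sum rat_ideal_mult)
         (use less.IH fps_idealD[OF assms(3)] in \<open>auto simp: fps_one_nth\<close>)
    finally show ?case by simp
  qed
  thus ?thesis by (simp add: fps_ideal_def)
qed

lemma qpoch_fps_ideal: "qpoch fps_X n \<in> fps_ideal p 0"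
proof (induction n)
  case (Suc n)
  have "(1 - fps_X ^ Suc n) * qpoch fps_X n \<in> fps_ideal p (0 + 0)"
    by (intro fps_ideal_mult fps_ideal_diff fps_ideal_1 fps_ideal_X_power Suc.IH)
  thus ?case by (simp add: qpoch_Suc)
qed simp

lemma euler_fps_ideal: "euler_fps \<in> fps_ideal p 0"
  using fps_idealD[OF qpoch_fps_ideal] by (simp add: fps_ideal_def euler_fps_def)

section \<open>The descent on the exponent of the prime\<close>

text \<open>A series in \<open>fps_X ^ l\<close> has coefficients only at multiples of
  \<open>l\<close>, so \<open>H\<close> enters only at indices congruent to \<open>N\<close> modulo
  \<open>l\<close>, where the dissection applies.\<close>

lemma dissects_mult_nth:
  assumes "dissects l d r C H" "l dvd 8 * N + d"
  shows "fps_nth (H * (K oo fps_X ^ l)) N =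
           C * fps_nth (fps_X ^ r * (H oo fps_X ^ (l ^ 2)) * (K oo fps_X ^ l)) N"
proof -
  define H' where "H' = fps_X ^ r * (H oo fps_X ^ (l ^ 2))"
  have "fps_nth H i * fps_nth (K oo fps_X ^ l) (N - i) = C * (fps_nth H' i * fps_nth (K oo fps_X ^ l) (N - i))"
    if i: "i \<le> N" for i
  proof (cases "l dvd N - i")
    case True
    have "8 * N + d = (8 * i + d) + 8 * (N - i)" using i by simp
    with assms(2) have "l dvd (8 * i + d) + 8 * (N - i)" by (simp only:)
    hence "l dvd 8 * i + d" by (simp only: dvd_add_left_iff[OF dvd_mult[OF True]])
    thus ?thesis using assms(1) by (simp add: dissects_def H'_def)
  qed (simp add: fps_nth_compose_X_power)
  hence "fps_nth (H * (K oo fps_X ^ l)) N = C * fps_nth (H' * (K oo fps_X ^ l)) N"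
    unfolding fps_mult_nth sum_distrib_left by (intro sum.cong refl) simp
  thus ?thesis by (simp only: H'_def)
qed

theorem dissects_prime_power_congruence:
  assumes "prime l" "dissects l d r C H" "C \<in> rat_ideal l 2" "8 * r + d = l ^ 2 * d"
    and HG: "H \<in> fps_ideal l 0" "G \<in> fps_ideal l 0"
    and N: "l ^ (2 * j + 1) dvd 8 * N + d"
  shows "fps_nth (H * G ^ (l ^ (2 * j + 1))) N \<in> rat_ideal l (2 * j + 1)"
proof -
  have l: "l > 0" using assms(1) prime_gt_0_nat by blast
  define c where "c = (\<lambda>j N. fps_nth (fps_X ^ r * (H oo fps_X ^ (l ^ 2)) * (G ^ (l ^ (2 * j)) oo fps_X ^ l)) N)"
  have frob: "G ^ (l ^ Suc k) - (G ^ (l ^ k) oo fps_X ^ l) \<in> fps_ideal l (Suc k)" for k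
  proof -
    have "(G oo fps_X ^ l) ^ (l ^ k) = G ^ (l ^ k) oo fps_X ^ l"
      by (rule fps_compose_power) (use l in simp)
    thus ?thesis using fps_ideal_frobenius_power[OF assms(1) HG(2), of k] by (simp only:)
  qed
  \<comment> \<open>Frobenius replaces the power of \<open>G\<close> by a series in
    \<open>fps_X ^ l\<close> with an error in the target ideal; the dissection then extracts
    \<open>C\<close>.\<close>
  have reduce: "fps_nth (H * G ^ (l ^ (2 * j + 1))) N \<in> rat_ideal l (2 * j + 1)"
    if N: "l ^ (2 * j + 1) dvd 8 * N + d" and c: "C * c j N \<in> rat_ideal l (2 * j + 1)" for j N
  proof -
    have "l dvd 8 * N + d" using N by (rule dvd_trans[rotated]) simp
    hence *: "fps_nth (H * (G ^ (l ^ (2 * j)) oo fps_X ^ l)) N = C * c j N"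
      unfolding c_def using assms(2) by (intro dissects_mult_nth)
    have "H * (G ^ (l ^ Suc (2 * j)) - (G ^ (l ^ (2 * j)) oo fps_X ^ l)) \<in> fps_ideal l (0 + Suc (2 * j))"
      by (intro fps_ideal_mult HG frob)
    from fps_idealD[OF this, of N]
    have "fps_nth (H * G ^ (l ^ (2 * j + 1))) N - C * c j N \<in> rat_ideal l (2 * j + 1)"
      by (simp add: right_diff_distrib * del: power_Suc)
    from rat_ideal_add[OF this c] show ?thesis by simp
  qed
  show ?thesis using N
  proof (induction j arbitrary: N)
    case 0
    have "fps_X ^ r * (H oo fps_X ^ (l ^ 2)) * (G ^ (l ^ (2 * 0)) oo fps_X ^ l) \<in> fps_ideal l (0 + 0 + 0 * l ^ (2 * 0))"
      by (intro fps_ideal_mult fps_ideal_X_power fps_ideal_compose_X_power fps_ideal_power HG)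
    hence "c 0 N \<in> rat_ideal l 0" unfolding c_def by (intro fps_idealD) simp
    \<comment> \<open>For exponent 1 the divisibility of \<open>C\<close> alone suffices.\<close>
    hence "C * c 0 N \<in> rat_ideal l (2 + 0)" by (intro rat_ideal_mult assms)
    hence "C * c 0 N \<in> rat_ideal l (2 * 0 + 1)" by (rule rat_ideal_mono) simp
    thus ?case by (rule reduce[OF 0])
  next
    case (Suc j)
    define L where "L = G ^ (l ^ (2 * j + 1))"
    have "(L oo fps_X ^ l) oo fps_X ^ l = L oo fps_X ^ (l ^ 2)"
      using l by (simp add: fps_compose_assoc[symmetric] fps_X_power_compose power2_eq_square flip: power_mult)
    \<comment> \<open>A second use of Frobenius produces a series in \<open>fps_X ^ (l ^ 2)\<close>,
      which can be merged with the dissected \<open>H\<close>.\<close>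
    hence comp: "(G ^ (l ^ (2 * Suc j)) oo fps_X ^ l) - (L oo fps_X ^ (l ^ 2)) =
                   (G ^ (l ^ Suc (2 * j + 1)) - (L oo fps_X ^ l)) oo fps_X ^ l"
      by (simp add: fps_compose_sub_distrib)
    have "fps_X ^ r * (H oo fps_X ^ (l ^ 2)) * ((G ^ (l ^ (2 * Suc j)) oo fps_X ^ l) - (L oo fps_X ^ (l ^ 2)))
            \<in> fps_ideal l (0 + 0 + Suc (2 * j + 1))"
      unfolding comp unfolding L_def
      by (intro fps_ideal_mult fps_ideal_X_power fps_ideal_compose_X_power HG frob)
    from fps_idealD[OF this, of N]
    have "c (Suc j) N - fps_nth (fps_X ^ r * ((H * L) oo fps_X ^ (l ^ 2))) N \<in> rat_ideal l (Suc (2 * j + 1))"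
      using l by (simp add: c_def right_diff_distrib fps_compose_mult_distrib mult.assoc)
    \<comment> \<open>The weaker modulus is enough, since \<open>C\<close> supplies two more factors
      \<open>l\<close>.\<close>
    hence "c (Suc j) N - fps_nth (fps_X ^ r * ((H * L) oo fps_X ^ (l ^ 2))) N \<in> rat_ideal l (2 * j + 1)"
      by (rule rat_ideal_mono) simp
    moreover have "fps_nth (fps_X ^ r * ((H * L) oo fps_X ^ (l ^ 2))) N \<in> rat_ideal l (2 * j + 1)"
    proof (cases "r \<le> N \<and> l ^ 2 dvd N - r")
      case True
      then obtain n where "N - r = l ^ 2 * n" by blast
      hence n: "N = r + l ^ 2 * n" using True by simp
      \<comment> \<open>Dividing by \<open>l ^ 2\<close> yields the divisibility that the induction
        hypothesis needs at \<open>n\<close>.\<close>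
      have "8 * N + d = l ^ 2 * (8 * n + d)"
        using assms(4) by (simp add: n algebra_simps)
      moreover have "l ^ (2 * Suc j + 1) = l ^ 2 * l ^ (2 * j + 1)"
        by (simp flip: power_add)
      ultimately have "l ^ 2 * l ^ (2 * j + 1) dvd l ^ 2 * (8 * n + d)"
        using Suc.prems by (simp only:)
      hence "l ^ (2 * j + 1) dvd 8 * n + d"
        by (rule dvd_times_left_cancel_iff[THEN iffD1, rotated]) (use l in simp)
      hence "fps_nth (H * L) n \<in> rat_ideal l (2 * j + 1)"
        unfolding L_def by (rule Suc.IH)
      thus ?thesis using l by (simp add: n fps_X_power_mult_nth fps_nth_compose_X_power)
    qed (auto simp: fps_X_power_mult_nth fps_nth_compose_X_power)
    ultimately have "c (Suc j) N \<in> rat_ideal l (2 * j + 1)"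
      using rat_ideal_add by fastforce
    hence "C * c (Suc j) N \<in> rat_ideal l (2 + (2 * j + 1))"
      by (intro rat_ideal_mult assms)
    thus ?case by (intro reduce Suc.prems) simp
  qed
qed

subsection \<open>The generating functions\<close>

lemma p1_factor_add:
  assumes "m > 0" "j > 0"
  shows "p1_factor m (s + t) j = p1_factor m s j * p1_factor m t j"
  using assms unfolding p1_factor_def fps_rat_power_def fps_binomial_add_mult
  by (intro fps_compose_mult_distrib) simp

text \<open>\<open>has_prod\<close> permits skipping an initial segment that contains zero factors;
  constant terms 1 exclude such factors, so the full partial products converge.\<close>

lemma tendsto_p1_gf:
  assumes "m > 0"
  shows "(\<lambda>N. \<Prod>j<N. p1_factor m t (Suc j)) \<longlonglongrightarrow> p1_gf m t"
proof -
  have "p1_factor m t (Suc j) \<noteq> 0" for j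
    using p1_factor_nth_0[of m t "Suc j"] by (auto simp del: p1_factor_nth_0)
  hence "raw_has_prod (\<lambda>j. p1_factor m t (Suc j)) 0 (p1_gf m t)"
    using p1_gf_has_prod[OF assms, of t] by (auto simp: has_prod_def)
  hence "(\<lambda>N. \<Prod>j\<le>N. p1_factor m t (Suc j)) \<longlonglongrightarrow> p1_gf m t"
    by (simp add: raw_has_prod_def)
  thus ?thesis
    by (subst filterlim_sequentially_Suc[symmetric]) (simp add: lessThan_Suc_atMost)
qed

lemma p1_gf_add:
  assumes "m > 0"
  shows "p1_gf m (s + t) = p1_gf m s * p1_gf m t"
proof (rule LIMSEQ_unique)
  show "(\<lambda>N. \<Prod>j<N. p1_factor m (s + t) (Suc j)) \<longlonglongrightarrow> p1_gf m (s + t)"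
    by (rule tendsto_p1_gf[OF assms])
  have "(\<lambda>N. (\<Prod>j<N. p1_factor m s (Suc j)) * (\<Prod>j<N. p1_factor m t (Suc j)))
          \<longlonglongrightarrow> p1_gf m s * p1_gf m t"
    by (intro tendsto_fps_mult tendsto_p1_gf assms)
  thus "(\<lambda>N. \<Prod>j<N. p1_factor m (s + t) (Suc j)) \<longlonglongrightarrow> p1_gf m s * p1_gf m t"
    by (simp add: p1_factor_add assms prod.distrib)
qed

lemma p1_gf_0: "m > 0 \<Longrightarrow> p1_gf m 0 = 1"
proof (rule LIMSEQ_unique)
  assume "m > 0"
  thus "(\<lambda>N. \<Prod>j<N. p1_factor m 0 (Suc j)) \<longlonglongrightarrow> p1_gf m 0"
    by (rule tendsto_p1_gf)
qed (simp add: p1_factor_def fps_rat_power_def)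

lemma p1_gf_of_nat_mult: "m > 0 \<Longrightarrow> p1_gf m (of_nat n * t) = p1_gf m t ^ n"
  by (induction n) (simp_all add: p1_gf_0 p1_gf_add distrib_right)

lemma p1_gf_nth_0: "m > 0 \<Longrightarrow> fps_nth (p1_gf m t) 0 = 1"
proof -
  assume "m > 0"
  have "fps_nth (\<Prod>j<N. p1_factor m t (Suc j)) 0 = 1" for N
    by (induction N) simp_all
  moreover have "eventually (\<lambda>N. fps_nth (\<Prod>j<N. p1_factor m t (Suc j)) 0 = fps_nth (p1_gf m t) 0) sequentially"
    using tendsto_p1_gf[OF \<open>m > 0\<close>, of t] unfolding tendsto_fps_iff by blast
  ultimately show ?thesis by simp
qed

lemma p1_gf_1: "m > 0 \<Longrightarrow> p1_gf m 1 = euler_fps * euler_power m"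
proof (rule LIMSEQ_unique)
  assume m: "m > 0"
  show "(\<lambda>N. \<Prod>j<N. p1_factor m 1 (Suc j)) \<longlonglongrightarrow> p1_gf m 1"
    using m by (rule tendsto_p1_gf)
  have "p1_factor m 1 (Suc j) = (1 - fps_X ^ Suc j) * (1 - (fps_X ^ m) ^ Suc j)" for j
    using m by (simp add: p1_factor_def fps_rat_power_def fps_binomial_1 fps_compose_add_distrib
                  power_mult[symmetric] del: power_Suc)
  hence "(\<Prod>j<N. p1_factor m 1 (Suc j)) = qpoch fps_X N * qpoch (fps_X ^ m) N" for N
    by (simp only: qpoch_def prod.distrib)
  thus "(\<lambda>N. \<Prod>j<N. p1_factor m 1 (Suc j)) \<longlonglongrightarrow> euler_fps * euler_power m"
    using m by (simp only:) (intro tendsto_fps_mult tendsto_qpoch tendsto_qpoch_X_power)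
qed

lemma rat_cong_0_rat_ideal:
  assumes "x \<in> rat_ideal p k" "prime p"
  shows "rat_cong_0 x (int p ^ k)"
proof -
  from assms(1) obtain a b where ab: "coprime b (int p)" "b \<noteq> 0" "x = of_nat p ^ k * of_int a / of_int b"
    by (elim rat_idealE)
  obtain u v where uv: "quotient_of x = (u, v)" by (cases "quotient_of x")
  have v: "v > 0" and x: "x = of_int u / of_int v"
    using quotient_of_denom_pos[OF uv] quotient_of_div[OF uv] by auto
  have "(of_int (u * b) :: rat) = of_int (int p ^ k * a * v)"
    using ab x v by (simp add: field_simps)
  hence "u * b = int p ^ k * (a * v)" by (simp only: of_int_eq_iff mult.assoc)
  hence "int p ^ k dvd u * b" by simp
  hence "int p ^ k dvd u" using ab(1) by (simp add: coprime_dvd_mult_left_iff coprime_commute)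
  thus ?thesis by (simp add: rat_cong_0_def uv)
qed

text \<open>The exponent splits as \<open>a + l ^ k * (- 1 / b)\<close>. The series \<open>G\<close>
  with exponent \<open>- 1 / b\<close> is integral at \<open>l\<close> because \<open>G ^ b\<close>
  is inverse to \<open>E\<close> and \<open>b\<close> is coprime to \<open>l\<close>.\<close>

lemma p1_congruence:
  assumes l: "prime l" and m: "m > 0" and k: "odd k" and b: "b > 0" "coprime b l"
    and H: "dissects l d r C ((euler_fps * euler_power m) ^ a)" "C \<in> rat_ideal l 2" "8 * r + d = l ^ 2 * d"
    and N: "l ^ k dvd 8 * N + d"
  shows "rat_cong_0 (p1 m (- (of_nat l ^ k - of_nat a * of_nat b) / of_nat b) N) (int l ^ k)"
proof -
  define E where "E = euler_fps * euler_power m"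
  define G where "G = p1_gf m (- 1 / of_nat b)"
  have "E \<in> fps_ideal l (0 + 0)"
    unfolding E_def by (intro fps_ideal_mult fps_ideal_compose_X_power euler_fps_ideal)
  hence E: "E \<in> fps_ideal l 0" by simp
  have "G ^ b * E = p1_gf m (of_nat b * (- 1 / of_nat b) + 1)"
    using m by (simp only: p1_gf_add p1_gf_of_nat_mult p1_gf_1 G_def E_def)
  also have "\<dots> = 1"
    using b m by (simp add: p1_gf_0)
  finally have "G ^ b \<in> fps_ideal l 0"
    by (rule fps_ideal_cofactor_of_1) (use E in \<open>simp_all add: E_def\<close>)
  hence G: "G \<in> fps_ideal l 0"
    using b m by (intro fps_ideal_root[of G b]) (simp_all add: G_def p1_gf_nth_0)
  have "- (of_nat l ^ k - of_nat a * of_nat b) / of_nat b =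
        of_nat a * 1 + of_nat (l ^ k) * (- 1 / of_nat b :: rat)"
    using b by (simp add: field_simps)
  hence gf: "p1_gf m (- (of_nat l ^ k - of_nat a * of_nat b) / of_nat b) = E ^ a * G ^ (l ^ k)"
    using m by (simp only: p1_gf_add p1_gf_of_nat_mult p1_gf_1 G_def E_def)
  obtain j where j: "k = 2 * j + 1" using k by (elim oddE)
  have "fps_nth (E ^ a * G ^ (l ^ k)) N \<in> rat_ideal l k"
    unfolding j
    by (rule dissects_prime_power_congruence)
       (use l H N G fps_ideal_power[OF E, of a] in \<open>simp_all add: E_def j\<close>)
  thus ?thesis
    unfolding p1_def gf by (rule rat_cong_0_rat_ideal[OF _ l])
qed

theorem theorem1p21:
  fixes k :: nat
  assumes "odd k" and "k > 1"
  shows "(\<forall>n b :: nat. b > 0 \<and> coprime b 3 \<longrightarrow>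
            rat_cong_0
              (p1 2 (- (3 ^ k - 5 * of_nat b) / of_nat b) (3 ^ k * n + (7 * 3 ^ k - 5) div 8))
              (3 ^ k))
       \<and> (\<forall>n b :: nat. b > 0 \<and> coprime b 5 \<longrightarrow>
            rat_cong_0
              (p1 2 (- (5 ^ k - 3 * of_nat b) / of_nat b) (5 ^ k * n + (7 * 5 ^ k - 3) div 8))
              (5 ^ k))
       \<and> (\<forall>n b :: nat. b > 0 \<and> coprime b 5 \<longrightarrow>
            rat_cong_0
              (p1 3 (- (5 ^ k - 3 * of_nat b) / of_nat b) (5 ^ k * n + (5 ^ k - 1) div 2))
              (5 ^ k))"
proof (intro conjI allI impI; elim conjE)
  fix n b :: nat assume b: "b > 0"
  have const: "(- 81 :: rat) \<in> rat_ideal 3 2" "(25 :: rat) \<in> rat_ideal 5 2"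
    using rat_ideal_of_int[of 3 2 "-9"] rat_ideal_of_int[of 5 2 1] by simp_all
  {
    assume "coprime b 3"
    \<comment> \<open>This bound keeps the truncated subtraction \<open>7 * 3 ^ k - 5\<close>
      exact.\<close>
    have "(3::nat) ^ k \<ge> 3 ^ 1" using assms by (intro power_increasing) auto
    hence "8 * (3 ^ k * n + (7 * 3 ^ k - 5) div 8) + 5 = 3 ^ k * (8 * n + 7)"
      using eight_dvd_offset_3[OF assms(1)] by (simp add: algebra_simps)
    hence "3 ^ k dvd 8 * (3 ^ k * n + (7 * 3 ^ k - 5) div 8) + 5"
      by (metis dvd_triv_left)
    thus "rat_cong_0 (p1 2 (- (3 ^ k - 5 * of_nat b) / of_nat b) (3 ^ k * n + (7 * 3 ^ k - 5) div 8)) (3 ^ k)"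
      using p1_congruence[of 3 2 k b 5 5 "- 81" 5] \<open>coprime b 3\<close> b assms const euler_fifth_power_dissects
      by simp
  }
  {
    assume "coprime b 5"
    have "(5::nat) ^ k \<ge> 5 ^ 1" using assms by (intro power_increasing) auto
    hence "8 * (5 ^ k * n + (7 * 5 ^ k - 3) div 8) + 3 = 5 ^ k * (8 * n + 7)"
      using eight_dvd_offset_5[OF assms(1)] by (simp add: algebra_simps)
    hence "5 ^ k dvd 8 * (5 ^ k * n + (7 * 5 ^ k - 3) div 8) + 3"
      by (metis dvd_triv_left)
    thus "rat_cong_0 (p1 2 (- (5 ^ k - 3 * of_nat b) / of_nat b) (5 ^ k * n + (7 * 5 ^ k - 3) div 8)) (5 ^ k)"
      using p1_congruence[of 5 2 k b 3 9 25 3] \<open>coprime b 5\<close> b assms const euler_cube_dissects[of 2 3 9]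
      by simp
  }
  {
    assume "coprime b 5"
    have "(5::nat) ^ k \<ge> 5 ^ 1" using assms by (intro power_increasing) auto
    moreover have "2 * ((5 ^ k - 1) div 2) = (5 ^ k - 1 :: nat)"
      using two_dvd_offset_5 by (rule dvd_mult_div_cancel)
    ultimately have "2 * ((5 ^ k - 1) div 2) + 1 = (5 ^ k :: nat)"
      by (simp only:) simp
    \<comment> \<open>For \<open>m = 3\<close> the dissection has \<open>d = 1 + 3 = 4\<close>, so
      the progression is brought to the form \<open>8 * N + 4\<close>.\<close>
    hence "8 * ((5 ^ k - 1) div 2) + 4 = (4 * 5 ^ k :: nat)"
      by linarith
    hence "8 * (5 ^ k * n + (5 ^ k - 1) div 2) + 4 = 5 ^ k * (8 * n + 4)"
      by (simp add: algebra_simps)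
    hence "5 ^ k dvd 8 * (5 ^ k * n + (5 ^ k - 1) div 2) + 4"
      by (metis dvd_triv_left)
    thus "rat_cong_0 (p1 3 (- (5 ^ k - 3 * of_nat b) / of_nat b) (5 ^ k * n + (5 ^ k - 1) div 2)) (5 ^ k)"
      using p1_congruence[of 5 3 k b 4 12 25 3] \<open>coprime b 5\<close> b assms const euler_cube_dissects[of 3 4 12]
      by simp
  }
qed

end
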